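(* Let $H_\alpha=\Delta_\alpha+Q$ be the magnetic Schrödinger operator on $\ell^2(\mathcal V)$ with a $\Gamma$-periodic magnetic potential $\alpha$ and a $\Gamma$-periodic electric potential $Q$ on a $\Gamma$-periodic graph $\mathcal G=(\mathcal V,\mathcal E)$, let $H_\alpha(k)$, $k\in\mathbb T^d$, be its fiber operators on $\ell^2(\mathcal V_* )$, and let $\nu=\#\mathcal V_*$. For $n\in\mathbb N$ and $\mathfrak m\in\mathbb Z^d$ let $\mathfrak h_{\alpha,n,\mathfrak m}$ be the Fourier coefficients of $\operatorname{Tr}H_\alpha^n(k)$, i.e. $\operatorname{Tr}H^n_\alpha(k)=\sum_{\mathfrak m\in\mathbb Z^d}\mathfrak h_{\alpha,n,\mathfrak m}e^{-i\langle\mathfrak m,k\rangle}$. Then the following statements are equivalent: (i) The spectrum of $H_\alpha$ is flat. (ii) For each $n\in\{1,\dots,\nu\}$ the trace of $H_\alpha^n(k)$ does not depend on $k\in\mathbb T^d$. (iii) For all $n\in\{1,\dots,\nu\}$ and all $\mathfrak m\in\mathbb Z^d\setminus\{0\}$, $$\mathfrak h_{\alpha,n,\mathfrak m}=\sum_{\mathbf c\in\widetilde{\mathcal C}_{n,\mathfrak m}}\omega(\mathbf c)\,e^{-i\alpha(\mathbf c)}=0.$$ (iv) For every $n\in\{1,\dots,\nu\}$, $$\frac1{(2\pi)^d}\int_{\mathbb T^d}\big(\operatorname{Tr}H_\alpha^n(k)\big)^2\,dk=|\mathfrak h_{\alpha,n,0}|^2,\qquad\text{where}\quad \mathfrak h_{\alpha,n,0}=\sum_{\mathbf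 c\in\widetilde{\mathcal C}_{n,0}}\omega(\mathbf c)\,e^{-i\alpha(\mathbf c)}.$$
   Context: **Periodic graphs.** $\mathcal G=(\mathcal V,\mathcal E)$ is a connected infinite graph, possibly with loops and multiple edges, embedded into $\mathbb R^d$; $\mathcal V$ is its vertex set and $\mathcal E$ its set of unoriented edges. Each edge in $\mathcal E$ is given two orientations, and $\mathcal A$ is the set of all oriented edges. An oriented edge starting at $u$ and ending at $v$ is written $(u,v)\in\mathcal A$ (multiple edges are distinguished), and $\underline{\mathbf e}=(v,u)$ is the inverse edge of $\mathbf e=(u,v)$. The degree $\varkappa_v$ of a vertex $v$ is the number of oriented edges starting at $v$. $\Gamma\subset\mathbb R^d$ is a lattice of rank $d$ with basis $a_1,\dots,a_d$ and fundamental cell $\Omega=\{\sum_{s=1}^d t_sa_s:0\le t_s<1\}$. The graph is $\Gamma$-periodic: it is locally finite, $\mathcal G+a=\mathcal G$ for all $a\in\Gamma$, and the quotient (fundamental) graph $\mathcal G_*=\mathcal G/\Gamma$ is finite. Write $\mathcal V_*=\mathcal V/\Gamma$ (identified with $\mathcal V\cap\Omega$), $\mathcal E_*=\mathcal E/\Gamma$, $\mathcal A_*=\mathcal A/\Gamma$, and $\nu=\#\mathcal V_*$. **Operators.** A magnetic vector potential is a function $\alpha:\mathcal A\to\mathbb R$ with $\alpha(\underline{\mathbf e})=-\alpha(\mathbf e)$; an electric potential is a function $Q:\mathcal V\to\mathbb R$. Periodicity means $\alpha(\mathbf e+a)=\alpha(\mathbf e)$ and $Q(v+a)=Q(v)$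 for all $a\in\Gamma$; so $\alpha$ and $Q$ are also defined on $\mathcal A_*$ and $\mathcal V_*$. On $\ell^2(\mathcal V)$, $$(\Delta_\alpha f)(v)=\sum_{\mathbf e=(v,u)\in\mathcal A}\big(f(v)-e^{i\alpha(\mathbf e)}f(u)\big),\qquad H_\alpha=\Delta_\alpha+Q,$$ and $H_\alpha$ is bounded and self-adjoint. **Edge indices.** Each $v\in\mathcal V$ is uniquely $v=v_0+[v]$ with $v_0\in\Omega$, $[v]\in\Gamma$. Let $[v]_{\mathbb A}\in\mathbb Z^d$ be the coordinate vector of $[v]$ in the basis $a_1,\dots,a_d$. The index of $\mathbf e=(u,v)\in\mathcal A$ is $\tau(\mathbf e)=[v]_{\mathbb A}-[u]_{\mathbb A}\in\mathbb Z^d$; it is $\Gamma$-periodic and so is defined on $\mathcal A_*$. **Fiber operators.** With $\mathbb T^d=\mathbb R^d/(2\pi\mathbb Z)^d$, $H_\alpha$ is unitarily equivalent (via the Gelfand transform) to the direct integral over $k\in\mathbb T^d$ (with measure $dk/(2\pi)^d$) of the operators $H_\alpha(k)=\Delta_\alpha(k)+Q$ on $\ell^2(\mathcal V_* )=\mathbb C^\nu$, where $$(\Delta_\alpha(k)f)(v)=\sum_{\mathbf e=(v,u)\in\mathcal A_*}\big(f(v)-e^{i(\alpha(\mathbf e)+\langle\tau(\mathbf e),k\rangle)}f(u)\big),\qquad v\in\mathcal V_*,$$ and $\langle\cdot,\cdot\rangle$ is the standard inner product in $\mathbb R^d$. Let $\lambda_{\alpha,1}(k)\le\dots\le\lambda_{\alpha,\nu}(k)$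 be the eigenvalues of $H_\alpha(k)$, counted with multiplicity. The functions $\lambda_{\alpha,j}(\cdot)$ are the (continuous) band functions, and $\sigma(H_\alpha)=\bigcup_{j=1}^\nu\lambda_{\alpha,j}(\mathbb T^d)$. This spectrum is the union of the absolutely continuous spectrum and the flat spectrum, the latter being the finite set of eigenvalues of $H_\alpha$ of infinite multiplicity. "The spectrum of $H_\alpha$ is flat" means that the absolutely continuous spectrum of $H_\alpha$ is empty, i.e. all band functions $\lambda_{\alpha,j}(\cdot)$ are constant. **Modified fundamental graph and cycles.** Let $\widetilde{\mathcal G}_*=(\mathcal V_*,\widetilde{\mathcal A}_* )$, where $\widetilde{\mathcal A}_*=\mathcal A_*\cup\{\mathbf e_v\}_{v\in\mathcal V_*}$ is obtained by adding at each vertex $v\in\mathcal V_*$ one new oriented loop $\mathbf e_v=(v,v)$ with $\tau(\mathbf e_v)=0$ and $\alpha(\mathbf e_v)=0$. A cycle of length $|\mathbf c|=n\ge1$ is a sequence $\mathbf c=(\mathbf e_1,\dots,\mathbf e_n)$ of oriented edges $\mathbf e_s=(v_{s-1},v_s)$ with $v_0=v_n$ (repetitions of edges and vertices and backtracking are allowed; a cycle is determined by its edge sequence, so different sequences, including cyclic shifts, are different cycles). $\widetilde{\mathcal C}$ is the set of all cycles of $\widetilde{\mathcal G}_*$. For $\mathbf c=(\mathbf e_1,\dots,\mathbf e_n)\in\widetilde{\mathcal C}$: the index is $\tau(\mathbf c)=\sum_{s=1}^n\tau(\mathbf e_s)\in\mathbb Z^d$; the flux is $\alpha(\mathbf c)=\sum_{s=1}^n\alpha(\mathbf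 e_s)$ modulo $2\pi$; the weight is $\omega(\mathbf c)=\omega(\mathbf e_1)\cdots\omega(\mathbf e_n)$, where $\omega(\mathbf e)=-1$ for $\mathbf e\in\mathcal A_*$ and $\omega(\mathbf e_v)=\varkappa_v+Q(v)$. Finally $\widetilde{\mathcal C}_{n,\mathfrak m}=\{\mathbf c\in\widetilde{\mathcal C}:|\mathbf c|=n,\ \tau(\mathbf c)=\mathfrak m\}$ for $n\in\mathbb N$, $\mathfrak m\in\mathbb Z^d$. *)

theory Defs
  imports
    "HOL-Analysis.Analysis"
    "Jordan_Normal_Form.Char_Poly"
    "Graph_Theory.Graph_Theory"
begin

section \<open>Lattices\<close>

definition real_vec :: "int ^ 'd \<Rightarrow> real ^ 'd" where
  "real_vec m = (\<chi> s. real_of_int (vec_nth m s))"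

definition lattice_point :: "('d::finite \<Rightarrow> real ^ 'd) \<Rightarrow> int ^ 'd \<Rightarrow> real ^ 'd" where
  "lattice_point b m = (\<Sum>s\<in>UNIV. real_of_int (vec_nth m s) *\<^sub>R b s)"

definition period_lattice :: "('d::finite \<Rightarrow> real ^ 'd) \<Rightarrow> (real ^ 'd) set" where
  "period_lattice b = range (lattice_point b)"

definition fundamental_cell :: "('d::finite \<Rightarrow> real ^ 'd) \<Rightarrow> (real ^ 'd) set" where
  "fundamental_cell b = {\<Sum>s\<in>UNIV. t s *\<^sub>R b s | t. \<forall>s. 0 \<le> t s \<and> t s < (1::real)}"

text \<open>The decomposition \<open>v = v\<^sub>0 + [v]\<close> with \<open>v\<^sub>0\<close> in the fundamental cell and \<open>[v]\<close> in the
  lattice; \<open>cell_index b v\<close> is the coordinate vector of \<open>[v]\<close> in the basis \<open>b\<close>, and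
  \<open>cell_part b v\<close> is \<open>v\<^sub>0\<close>.\<close>

definition cell_index :: "('d::finite \<Rightarrow> real ^ 'd) \<Rightarrow> real ^ 'd \<Rightarrow> int ^ 'd" where
  "cell_index b v = (THE m. v - lattice_point b m \<in> fundamental_cell b)"

definition cell_part :: "('d::finite \<Rightarrow> real ^ 'd) \<Rightarrow> real ^ 'd \<Rightarrow> real ^ 'd" where
  "cell_part b v = v - lattice_point b (cell_index b v)"

section \<open>Periodic graphs\<close>

text \<open>An unoriented multigraph is given by the digraph \<open>G\<close> of its oriented edges together with the
  fixed-point-free reversal \<open>arev\<close> (so a loop contributes two oriented edges).  Vertices are points
  of Euclidean space and lattice vectors translate them by addition.  Since multiple edges are
  distinguished, an edge is not determined by its end points, and the translation of edges is given
  separately as an action \<open>act\<close> of the lattice.\<close>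

definition quotient_verts ::
    "(real ^ 'd::finite, 'e) pre_digraph \<Rightarrow> ('d \<Rightarrow> real ^ 'd) \<Rightarrow> (real ^ 'd) set" where
  "quotient_verts G b = verts G \<inter> fundamental_cell b"

definition edge_orbit ::
    "('d::finite \<Rightarrow> real ^ 'd) \<Rightarrow> (real ^ 'd \<Rightarrow> 'e \<Rightarrow> 'e) \<Rightarrow> 'e \<Rightarrow> 'e set" where
  "edge_orbit b act e = (\<lambda>a. act a e) ` period_lattice b"

text \<open>The value on an orbit of a function of edges that is constant on orbits.\<close>

definition on_orbit :: "('e \<Rightarrow> 'c) \<Rightarrow> 'e set \<Rightarrow> 'c" where
  "on_orbit f E = the_elem (f ` E)"

definition quotient_graph ::
    "(real ^ 'd::finite, 'e) pre_digraph \<Rightarrow> ('d \<Rightarrow> real ^ 'd) \<Rightarrow> (real ^ 'd \<Rightarrow> 'e \<Rightarrow> 'e) \<Rightarrow>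
      (real ^ 'd, 'e set) pre_digraph" where
  "quotient_graph G b act =
    \<lparr> verts = quotient_verts G b,
      arcs = edge_orbit b act ` arcs G,
      tail = on_orbit (\<lambda>e. cell_part b (tail G e)),
      head = on_orbit (\<lambda>e. cell_part b (head G e)) \<rparr>"

locale periodic_graph = bidirected_digraph G arev
  for G :: "(real ^ 'd::finite, 'e) pre_digraph" and arev :: "'e \<Rightarrow> 'e" +
  fixes b :: "'d \<Rightarrow> real ^ 'd"
    and act :: "real ^ 'd \<Rightarrow> 'e \<Rightarrow> 'e"
  assumes basis_inj: "inj b"
    and basis_independent: "independent (range b)"
    and connected: "Digraph_Component.connected G"
    and infinite_verts: "infinite (verts G)"
    and locally_finite: "v \<in> verts G \<Longrightarrow> finite (out_arcs G v)"
    and translate_vert: "a \<in> period_lattice b \<Longrightarrow> v \<in> verts G \<Longrightarrow> v + a \<in> verts G"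
    and act_in_arcs: "a \<in> period_lattice b \<Longrightarrow> e \<in> arcs G \<Longrightarrow> act a e \<in> arcs G"
    and act_zero: "e \<in> arcs G \<Longrightarrow> act 0 e = e"
    and act_add: "a \<in> period_lattice b \<Longrightarrow> a' \<in> period_lattice b \<Longrightarrow> e \<in> arcs G \<Longrightarrow>
                    act (a + a') e = act a (act a' e)"
    and tail_act: "a \<in> period_lattice b \<Longrightarrow> e \<in> arcs G \<Longrightarrow> tail G (act a e) = tail G e + a"
    and head_act: "a \<in> period_lattice b \<Longrightarrow> e \<in> arcs G \<Longrightarrow> head G (act a e) = head G e + a"
    and arev_act: "a \<in> period_lattice b \<Longrightarrow> e \<in> arcs G \<Longrightarrow> arev (act a e) = act a (arev e)"
    and finite_quotient: "fin_digraph (quotient_graph G b act)"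

definition periodic_magnetic_potential ::
    "(real ^ 'd::finite, 'e) pre_digraph \<Rightarrow> ('e \<Rightarrow> 'e) \<Rightarrow> ('d \<Rightarrow> real ^ 'd) \<Rightarrow>
      (real ^ 'd \<Rightarrow> 'e \<Rightarrow> 'e) \<Rightarrow> ('e \<Rightarrow> real) \<Rightarrow> bool" where
  "periodic_magnetic_potential G arev b act \<alpha> \<longleftrightarrow>
    (\<forall>e\<in>arcs G. \<alpha> (arev e) = - \<alpha> e) \<and> (\<forall>a\<in>period_lattice b. \<forall>e\<in>arcs G. \<alpha> (act a e) = \<alpha> e)"

definition periodic_electric_potential ::
    "(real ^ 'd::finite, 'e) pre_digraph \<Rightarrow> ('d \<Rightarrow> real ^ 'd) \<Rightarrow> (real ^ 'd \<Rightarrow> real) \<Rightarrow> bool" where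
  "periodic_electric_potential G b Q \<longleftrightarrow> (\<forall>a\<in>period_lattice b. \<forall>v\<in>verts G. Q (v + a) = Q v)"

definition edge_index ::
    "(real ^ 'd::finite, 'e) pre_digraph \<Rightarrow> ('d \<Rightarrow> real ^ 'd) \<Rightarrow> 'e \<Rightarrow> int ^ 'd" where
  "edge_index G b e = cell_index b (head G e) - cell_index b (tail G e)"

section \<open>The Schroedinger operator, its fibers and its band functions\<close>

definition schroedinger_op ::
    "(real ^ 'd::finite, 'e) pre_digraph \<Rightarrow> ('e \<Rightarrow> real) \<Rightarrow> (real ^ 'd \<Rightarrow> real) \<Rightarrow>
      (real ^ 'd \<Rightarrow> complex) \<Rightarrow> real ^ 'd \<Rightarrow> complex" where
  "schroedinger_op G \<alpha> Q f v =
    (\<Sum>e\<in>out_arcs G v. f v - exp (\<i> * \<alpha> e) * f (head G e)) + Q v * f v"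

definition fiber_op ::
    "(real ^ 'd::finite, 'e) pre_digraph \<Rightarrow> ('d \<Rightarrow> real ^ 'd) \<Rightarrow> (real ^ 'd \<Rightarrow> 'e \<Rightarrow> 'e) \<Rightarrow>
      ('e \<Rightarrow> real) \<Rightarrow> (real ^ 'd \<Rightarrow> real) \<Rightarrow> real ^ 'd \<Rightarrow>
      (real ^ 'd \<Rightarrow> complex) \<Rightarrow> real ^ 'd \<Rightarrow> complex" where
  "fiber_op G b act \<alpha> Q k f v =
    (\<Sum>E\<in>out_arcs (quotient_graph G b act) v.
        f v - exp (\<i> * (on_orbit \<alpha> E + inner (real_vec (on_orbit (edge_index G b) E)) k))
              * f (head (quotient_graph G b act) E))
    + Q v * f v"

text \<open>The fiber operator at \<open>k\<close> is the action of the Schroedinger operator on the Bloch functions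
  \<open>u \<mapsto> exp(i\<langle>[u], k\<rangle>) f(u\<^sub>0)\<close>, see \<open>schroedinger_op_bloch\<close> below.\<close>

context periodic_graph
begin

lemma lattice_point_eq_zero:
  assumes "(\<Sum>s\<in>UNIV. c s *\<^sub>R b s) = 0" shows "c s = 0"
proof -
  have "(\<Sum>v\<in>range b. c (inv_into UNIV b v) *\<^sub>R v) = (\<Sum>s\<in>UNIV. c s *\<^sub>R b s)"
    by (subst sum.reindex[OF basis_inj]) (simp add: basis_inj)
  then have "c (inv_into UNIV b (b s)) = 0"
    using independentD[OF basis_independent, of "range b" "\<lambda>v. c (inv_into UNIV b v)" "b s"] assms
    by simp
  then show ?thesis by (simp add: basis_inj)
qed

lemma basis_expansion: "\<exists>t. v = (\<Sum>s\<in>UNIV. t s *\<^sub>R b s)"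
proof -
  have "card (range b) = DIM(real ^ 'd)" using basis_inj by (simp add: card_image)
  then have "span (range b) = UNIV"
    using basis_independent by (metis card_eq_dim dim_UNIV independent_imp_finite inf_top.right_neutral
        order_antisym_conv subset_UNIV)
  then have "v \<in> span (range b)" by simp
  then obtain u where "v = (\<Sum>w\<in>range b. u w *\<^sub>R w)" by (auto simp: span_finite)
  then have "v = (\<Sum>s\<in>UNIV. u (b s) *\<^sub>R b s)" by (simp add: sum.reindex[OF basis_inj])
  then show ?thesis by (intro exI[of _ "\<lambda>s. u (b s)"])
qed

lemma cell_index_unique:
  assumes "v - lattice_point b m \<in> fundamental_cell b" "v - lattice_point b m' \<in> fundamental_cell b"
  shows "m = m'"
proof -
  obtain t where t: "v - lattice_point b m = (\<Sum>s\<in>UNIV. t s *\<^sub>R b s)" "\<And>s. 0 \<le> t s \<and> t s < (1::real)"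
    using assms(1) unfolding fundamental_cell_def by blast
  obtain t' where t': "v - lattice_point b m' = (\<Sum>s\<in>UNIV. t' s *\<^sub>R b s)" "\<And>s. 0 \<le> t' s \<and> t' s < (1::real)"
    using assms(2) unfolding fundamental_cell_def by blast
  have "(\<Sum>s\<in>UNIV. (real_of_int (vec_nth m s) + t s - real_of_int (vec_nth m' s) - t' s) *\<^sub>R b s)
      = (lattice_point b m + (v - lattice_point b m)) - (lattice_point b m' + (v - lattice_point b m'))"
    unfolding t t' by (simp add: lattice_point_def algebra_simps sum.distrib sum_subtractf)
  also have "\<dots> = 0" by simp
  finally have z: "real_of_int (vec_nth m s) + t s - real_of_int (vec_nth m' s) - t' s = 0" for s
    by (rule lattice_point_eq_zero)
  have "vec_nth m s = vec_nth m' s" for s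
    using z[of s] t(2)[of s] t'(2)[of s] by linarith
  then show ?thesis by (simp add: Finite_Cartesian_Product.vec_eq_iff)
qed

lemma cell_index_exists: "\<exists>m. v - lattice_point b m \<in> fundamental_cell b"
proof -
  obtain t where t: "v = (\<Sum>s\<in>UNIV. t s *\<^sub>R b s)" using basis_expansion by blast
  have "v - lattice_point b (\<chi> s. \<lfloor>t s\<rfloor>) = (\<Sum>s\<in>UNIV. frac (t s) *\<^sub>R b s)"
    by (simp add: t lattice_point_def frac_def algebra_simps sum_subtractf)
  moreover have "0 \<le> frac (t s) \<and> frac (t s) < 1" for s by (simp add: frac_lt_1)
  ultimately have "v - lattice_point b (\<chi> s. \<lfloor>t s\<rfloor>) \<in> fundamental_cell b"
    unfolding fundamental_cell_def by (intro CollectI exI[of _ "\<lambda>s. frac (t s)"]) simp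
  then show ?thesis ..
qed

lemma cell_index_eqI: "v - lattice_point b m \<in> fundamental_cell b \<Longrightarrow> cell_index b v = m"
  unfolding cell_index_def using cell_index_unique by blast

lemma cell_part_in_cell: "cell_part b v \<in> fundamental_cell b"
  unfolding cell_part_def using cell_index_exists[of v] cell_index_eqI by metis

lemma cell_index_translate:
  "cell_index b (v + lattice_point b m) = cell_index b v + m"
  by (rule cell_index_eqI, use cell_part_in_cell[of v] in
      \<open>simp add: cell_part_def lattice_point_def algebra_simps sum.distrib\<close>)

lemma cell_part_translate: "a \<in> period_lattice b \<Longrightarrow> cell_part b (v + a) = cell_part b v"
  unfolding period_lattice_def
  by (auto simp: cell_part_def cell_index_translate)
     (simp add: lattice_point_def algebra_simps sum.distrib)

lemma cell_index_in_cell: "v \<in> fundamental_cell b \<Longrightarrow> cell_index b v = 0"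
  by (rule cell_index_eqI) (simp add: lattice_point_def)

lemma cell_part_in_cell_eq: "v \<in> fundamental_cell b \<Longrightarrow> cell_part b v = v"
  by (simp add: cell_part_def cell_index_in_cell lattice_point_def)

lemma zero_in_lattice: "0 \<in> period_lattice b"
  unfolding period_lattice_def by (rule image_eqI[of _ _ 0]) (auto simp: lattice_point_def)

lemma uminus_in_lattice: "a \<in> period_lattice b \<Longrightarrow> - a \<in> period_lattice b"
  unfolding period_lattice_def
  by (auto intro!: image_eqI[of _ _ "- _"] simp: lattice_point_def sum_negf)

lemma on_orbit_eq:
  assumes "\<And>a. a \<in> period_lattice b \<Longrightarrow> f (act a e) = f e"
  shows "on_orbit f (edge_orbit b act e) = f e"
proof -
  have "f ` edge_orbit b act e = {f e}"
    using assms zero_in_lattice unfolding edge_orbit_def by (auto simp: image_image)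
  then show ?thesis by (simp add: on_orbit_def)
qed

lemma quotient_tail:
  "e \<in> arcs G \<Longrightarrow> tail (quotient_graph G b act) (edge_orbit b act e) = cell_part b (tail G e)"
  by (simp add: quotient_graph_def, rule on_orbit_eq) (simp add: tail_act cell_part_translate)

lemma quotient_head:
  "e \<in> arcs G \<Longrightarrow> head (quotient_graph G b act) (edge_orbit b act e) = cell_part b (head G e)"
  by (simp add: quotient_graph_def, rule on_orbit_eq) (simp add: head_act cell_part_translate)

lemma orbit_edge_index: "e \<in> arcs G \<Longrightarrow> on_orbit (edge_index G b) (edge_orbit b act e) = edge_index G b e"
  by (rule on_orbit_eq) (auto simp: edge_index_def tail_act head_act period_lattice_def cell_index_translate)

lemma edge_orbit_act:
  assumes "a \<in> period_lattice b" "e \<in> arcs G"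
  shows "edge_orbit b act (act a e) = edge_orbit b act e"
proof -
  have add: "a1 + a2 \<in> period_lattice b" if "a1 \<in> period_lattice b" "a2 \<in> period_lattice b" for a1 a2
    using that unfolding period_lattice_def
    by (auto intro!: image_eqI[of _ _ "_ + _"] simp: lattice_point_def sum.distrib algebra_simps)
  show ?thesis
  proof (intro equalityI subsetI)
    fix x assume "x \<in> edge_orbit b act (act a e)"
    then show "x \<in> edge_orbit b act e"
      using assms add by (auto simp: edge_orbit_def act_add[symmetric])
  next
    fix x assume "x \<in> edge_orbit b act e"
    then obtain c where c: "c \<in> period_lattice b" "x = act c e" by (auto simp: edge_orbit_def)
    then have "x = act (c + - a) (act a e)"
      using assms add[OF c(1) uminus_in_lattice[OF assms(1)]]
      by (simp add: act_add[symmetric])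
    then show "x \<in> edge_orbit b act (act a e)"
      using add[OF c(1) uminus_in_lattice[OF assms(1)]] unfolding edge_orbit_def by blast
  qed
qed

lemma bij_betw_out_arcs:
  assumes "v \<in> quotient_verts G b"
  shows "bij_betw (edge_orbit b act) (out_arcs G v) (out_arcs (quotient_graph G b act) v)"
proof (rule bij_betw_imageI)
  have v: "v \<in> fundamental_cell b" using assms by (simp add: quotient_verts_def)
  show "inj_on (edge_orbit b act) (out_arcs G v)"
  proof (rule inj_onI)
    fix e e' assume *: "e \<in> out_arcs G v" "e' \<in> out_arcs G v" "edge_orbit b act e = edge_orbit b act e'"
    have "act 0 e \<in> edge_orbit b act e" unfolding edge_orbit_def using zero_in_lattice by blast
    then obtain a where a: "a \<in> period_lattice b" "e = act a e'"
      using * act_zero by (auto simp: edge_orbit_def)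
    then have "a = 0" using * tail_act[of a e'] by auto
    then show "e = e'" using a * act_zero by simp
  qed
  show "edge_orbit b act ` out_arcs G v = out_arcs (quotient_graph G b act) v"
  proof (intro equalityI subsetI)
    fix E assume "E \<in> edge_orbit b act ` out_arcs G v"
    then show "E \<in> out_arcs (quotient_graph G b act) v"
      using quotient_tail v by (auto simp: cell_part_in_cell_eq) (simp add: quotient_graph_def)
  next
    fix E assume E: "E \<in> out_arcs (quotient_graph G b act) v"
    then obtain e where e: "e \<in> arcs G" "E = edge_orbit b act e"
      by (auto simp: quotient_graph_def)
    define a where "a = - lattice_point b (cell_index b (tail G e))"
    have a: "a \<in> period_lattice b" unfolding a_def by (rule uminus_in_lattice) (simp add: period_lattice_def)
    have "tail G (act a e) = v"
      using E e quotient_tail[OF e(1)] tail_act[OF a e(1)] by (simp add: cell_part_def a_def)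
    then show "E \<in> edge_orbit b act ` out_arcs G v"
      using edge_orbit_act[OF a e(1)] act_in_arcs[OF a e(1)] e by auto
  qed
qed

lemma schroedinger_op_bloch:
  assumes "periodic_magnetic_potential G arev b act \<alpha>" and v: "v \<in> quotient_verts G b"
  shows "schroedinger_op G \<alpha> Q
           (\<lambda>u. exp (\<i> * inner (real_vec (cell_index b u)) k) * f (cell_part b u)) v
         = fiber_op G b act \<alpha> Q k f v"
proof -
  have v': "v \<in> fundamental_cell b" using v by (simp add: quotient_verts_def)
  have z: "real_vec 0 = (0::real ^ 'd)" by (simp add: real_vec_def Finite_Cartesian_Product.vec_eq_iff)
  have "on_orbit \<alpha> (edge_orbit b act e) = \<alpha> e" if "e \<in> arcs G" for e
    using assms(1) that by (intro on_orbit_eq) (auto simp: periodic_magnetic_potential_def)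
  then show ?thesis
    unfolding schroedinger_op_def fiber_op_def sum.reindex_bij_betw[OF bij_betw_out_arcs[OF v], symmetric]
    using v' by (auto intro!: sum.cong simp: quotient_head orbit_edge_index edge_index_def
        cell_index_in_cell cell_part_in_cell_eq z ring_distribs exp_add)
qed

end

definition num_verts :: "(real ^ 'd::finite, 'e) pre_digraph \<Rightarrow> ('d \<Rightarrow> real ^ 'd) \<Rightarrow> nat" where
  "num_verts G b = card (quotient_verts G b)"

text \<open>An arbitrary enumeration of the quotient vertices; traces and eigenvalues below do not depend
  on it.\<close>

definition vert_list :: "(real ^ 'd::finite, 'e) pre_digraph \<Rightarrow> ('d \<Rightarrow> real ^ 'd) \<Rightarrow> (real ^ 'd) list"
  where "vert_list G b = (SOME vs. distinct vs \<and> set vs = quotient_verts G b)"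

definition fiber_mat ::
    "(real ^ 'd::finite, 'e) pre_digraph \<Rightarrow> ('d \<Rightarrow> real ^ 'd) \<Rightarrow> (real ^ 'd \<Rightarrow> 'e \<Rightarrow> 'e) \<Rightarrow>
      ('e \<Rightarrow> real) \<Rightarrow> (real ^ 'd \<Rightarrow> real) \<Rightarrow> real ^ 'd \<Rightarrow> complex Matrix.mat" where
  "fiber_mat G b act \<alpha> Q k =
    Matrix.mat (num_verts G b) (num_verts G b)
      (\<lambda>(i, j). fiber_op G b act \<alpha> Q k
                  (\<lambda>v. if v = vert_list G b ! j then 1 else 0) (vert_list G b ! i))"

definition mat_trace :: "'a::comm_monoid_add Matrix.mat \<Rightarrow> 'a" where
  "mat_trace A = (\<Sum>i<dim_row A. A $$ (i, i))"

definition fiber_trace ::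
    "(real ^ 'd::finite, 'e) pre_digraph \<Rightarrow> ('d \<Rightarrow> real ^ 'd) \<Rightarrow> (real ^ 'd \<Rightarrow> 'e \<Rightarrow> 'e) \<Rightarrow>
      ('e \<Rightarrow> real) \<Rightarrow> (real ^ 'd \<Rightarrow> real) \<Rightarrow> nat \<Rightarrow> real ^ 'd \<Rightarrow> complex" where
  "fiber_trace G b act \<alpha> Q n k = mat_trace (fiber_mat G b act \<alpha> Q k ^\<^sub>m n)"

text \<open>Eigenvalues in increasing order, counted with multiplicity; this is meaningful for matrices
  with real spectrum, in particular for the Hermitian fiber matrices.\<close>

definition sorted_eigenvalues :: "complex Matrix.mat \<Rightarrow> real list" where
  "sorted_eigenvalues A =
    (THE rs. sorted rs \<and> char_poly A = (\<Prod>r\<leftarrow>rs. [:- complex_of_real r, 1:]))"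

definition band_function ::
    "(real ^ 'd::finite, 'e) pre_digraph \<Rightarrow> ('d \<Rightarrow> real ^ 'd) \<Rightarrow> (real ^ 'd \<Rightarrow> 'e \<Rightarrow> 'e) \<Rightarrow>
      ('e \<Rightarrow> real) \<Rightarrow> (real ^ 'd \<Rightarrow> real) \<Rightarrow> nat \<Rightarrow> real ^ 'd \<Rightarrow> real" where
  "band_function G b act \<alpha> Q j k = sorted_eigenvalues (fiber_mat G b act \<alpha> Q k) ! (j - 1)"

text \<open>The spectrum of the Schroedinger operator is flat, i.e. has no absolutely continuous part,
  in the sense that all band functions are constant.\<close>

definition flat_spectrum ::
    "(real ^ 'd::finite, 'e) pre_digraph \<Rightarrow> ('d \<Rightarrow> real ^ 'd) \<Rightarrow> (real ^ 'd \<Rightarrow> 'e \<Rightarrow> 'e) \<Rightarrow>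
      ('e \<Rightarrow> real) \<Rightarrow> (real ^ 'd \<Rightarrow> real) \<Rightarrow> bool" where
  "flat_spectrum G b act \<alpha> Q \<longleftrightarrow>
    (\<forall>j\<in>{1..num_verts G b}. \<forall>k k'. band_function G b act \<alpha> Q j k = band_function G b act \<alpha> Q j k')"

text \<open>Functions on the torus are \<open>2\<pi>\<close>-periodic functions on Euclidean space; the normalised integral
  is taken over the cube of side \<open>2\<pi>\<close>.\<close>

definition torus_mean :: "(real ^ 'd::finite \<Rightarrow> complex) \<Rightarrow> complex" where
  "torus_mean f =
    complex_of_real (1 / (2 * pi) ^ CARD('d)) * set_lebesgue_integral lborel (cbox 0 (\<chi> s. 2 * pi)) f"

definition fourier_coeff :: "(real ^ 'd::finite \<Rightarrow> complex) \<Rightarrow> int ^ 'd \<Rightarrow> complex" where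
  "fourier_coeff f m = torus_mean (\<lambda>k. f k * exp (\<i> * inner (real_vec m) k))"

section \<open>Cycles of the modified fundamental graph\<close>

text \<open>\<open>Inr v\<close> is the new loop at \<open>v\<close>.\<close>

definition modified_graph ::
    "(real ^ 'd::finite, 'e) pre_digraph \<Rightarrow> ('d \<Rightarrow> real ^ 'd) \<Rightarrow> (real ^ 'd \<Rightarrow> 'e \<Rightarrow> 'e) \<Rightarrow>
      (real ^ 'd, 'e set + real ^ 'd) pre_digraph" where
  "modified_graph G b act =
    \<lparr> verts = quotient_verts G b,
      arcs = arcs (quotient_graph G b act) <+> quotient_verts G b,
      tail = case_sum (tail (quotient_graph G b act)) (\<lambda>v. v),
      head = case_sum (head (quotient_graph G b act)) (\<lambda>v. v) \<rparr>"

definition cycle_index ::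
    "(real ^ 'd::finite, 'e) pre_digraph \<Rightarrow> ('d \<Rightarrow> real ^ 'd) \<Rightarrow> ('e set + real ^ 'd) list \<Rightarrow> int ^ 'd"
  where
  "cycle_index G b c = (\<Sum>x\<leftarrow>c. case_sum (on_orbit (edge_index G b)) (\<lambda>_. 0) x)"

text \<open>A real representative of the flux, which is only relevant modulo \<open>2\<pi>\<close>.\<close>

definition cycle_flux :: "('e \<Rightarrow> real) \<Rightarrow> ('e set + real ^ 'd::finite) list \<Rightarrow> real" where
  "cycle_flux \<alpha> c = (\<Sum>x\<leftarrow>c. case_sum (on_orbit \<alpha>) (\<lambda>_. 0) x)"

definition cycle_weight ::
    "(real ^ 'd::finite, 'e) pre_digraph \<Rightarrow> (real ^ 'd \<Rightarrow> real) \<Rightarrow> ('e set + real ^ 'd) list \<Rightarrow> real"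
  where
  "cycle_weight G Q c = (\<Prod>x\<leftarrow>c. case_sum (\<lambda>_. - 1) (\<lambda>v. real (out_degree G v) + Q v) x)"

definition cycles ::
    "(real ^ 'd::finite, 'e) pre_digraph \<Rightarrow> ('d \<Rightarrow> real ^ 'd) \<Rightarrow> (real ^ 'd \<Rightarrow> 'e \<Rightarrow> 'e) \<Rightarrow>
      nat \<Rightarrow> int ^ 'd \<Rightarrow> ('e set + real ^ 'd) list set" where
  "cycles G b act n m =
    {c. c \<noteq> [] \<and> (\<exists>u. pre_digraph.awalk (modified_graph G b act) u c u) \<and>
        length c = n \<and> cycle_index G b c = m}"

definition cycle_sum ::
    "(real ^ 'd::finite, 'e) pre_digraph \<Rightarrow> ('d \<Rightarrow> real ^ 'd) \<Rightarrow> (real ^ 'd \<Rightarrow> 'e \<Rightarrow> 'e) \<Rightarrow>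
      ('e \<Rightarrow> real) \<Rightarrow> (real ^ 'd \<Rightarrow> real) \<Rightarrow> nat \<Rightarrow> int ^ 'd \<Rightarrow> complex" where
  "cycle_sum G b act \<alpha> Q n m =
    (\<Sum>c\<in>cycles G b act n m. cycle_weight G Q c * exp (- \<i> * cycle_flux \<alpha> c))"

end

theory Submission
  imports Defs "Jordan_Normal_Form.Schur_Decomposition"
begin

text \<open>The fiber matrix is the weighted adjacency matrix of the modified fundamental graph, so the trace
  of its \<open>n\<close>-th power is the sum of the weights of the cycles of length \<open>n\<close>: a trigonometric
  polynomial in \<open>k\<close>.  Reversing the arcs shows that the matrix is Hermitian, hence that the traces are
  real, and conjugation turns the cycle expansion into the Fourier series with coefficients
  \<open>\<Sum> \<omega>(c) exp(-i\<alpha>(c))\<close>.  Orthogonality of the characters gives the equivalence of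
  constant traces, vanishing coefficients and the Parseval-type identity.  By Newton's identities the
  traces of the first \<open>\<nu>\<close> powers determine the characteristic polynomial, that is, the band functions.\<close>

section \<open>Traces of matrix powers and eigenvalues\<close>

text \<open>Newton's identities determine the elementary symmetric functions recursively from the
  power sums; characteristic zero permits the division by \<open>Suc n\<close> in each step of the
  recursion.\<close>

lemma prod_linear_eq_of_power_sums_eq:
  fixes xs ys :: "'a::field_char_0 list"
  assumes len: "length xs = length ys"
    and sums: "\<And>n. n \<in> {1..length xs} \<Longrightarrow> (\<Sum>x\<leftarrow>xs. x ^ n) = (\<Sum>y\<leftarrow>ys. y ^ n)"
  shows "(\<Prod>x\<leftarrow>xs. [:- x, 1:]) = (\<Prod>y\<leftarrow>ys. [:- y, 1:])"
proof -
  \<comment> \<open>Newton's identities are the coefficients of \<open>F' = - F P\<close>, where \<open>P\<close> generates the power sums.\<close>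
  define F where "F zs = (\<Prod>z\<leftarrow>zs. [:1, - z:])" for zs :: "'a list"
  define P where "P zs = Abs_fps (\<lambda>n. \<Sum>z\<leftarrow>zs. z ^ Suc n)" for zs :: "'a list"
  have geometric: "fps_of_poly [:1, - z:] * Abs_fps (\<lambda>n. z ^ Suc n) = fps_const z" for z :: 'a
  proof (rule fps_ext)
    fix n
    show "fps_nth (fps_of_poly [:1, - z:] * Abs_fps (\<lambda>n. z ^ Suc n)) n = fps_nth (fps_const z) n"
      by (cases n) (simp_all add: fps_of_poly_linear' ring_distribs mult.assoc fps_X_mult_nth)
  qed
  \<comment> \<open>Logarithmic differentiation: by \<open>geometric\<close>, a factor
    \<open>[:1, - z:]\<close> has logarithmic derivative minus the series of the powers
    \<open>z ^ Suc n\<close>, and these series add up to \<open>- P zs\<close>.\<close>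
  have newton: "fps_deriv (fps_of_poly (F zs)) = - (fps_of_poly (F zs) * P zs)" for zs
  proof (induction zs)
    case Nil
    then show ?case by (simp add: F_def P_def fps_ext)
  next
    case (Cons z zs)
    let ?L = "fps_of_poly [:1, - z:]"
    have F: "fps_of_poly (F (z # zs)) = ?L * fps_of_poly (F zs)"
      by (simp add: F_def fps_of_poly_mult del: mult_pCons_left)
    have P: "P (z # zs) = Abs_fps (\<lambda>n. z ^ Suc n) + P zs"
      by (rule fps_ext) (simp add: P_def)
    have L: "fps_deriv ?L = - fps_const z"
      by (simp add: fps_of_poly_linear')
    have "fps_deriv (fps_of_poly (F (z # zs)))
        = - (?L * Abs_fps (\<lambda>n. z ^ Suc n)) * fps_of_poly (F zs) - ?L * (fps_of_poly (F zs) * P zs)"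
      unfolding F fps_deriv_mult Cons L geometric by simp
    also have "\<dots> = - (fps_of_poly (F (z # zs)) * P (z # zs))"
      unfolding F P by (simp add: algebra_simps)
    finally show ?case .
  qed
  have rec: "of_nat (Suc n) * coeff (F zs) (Suc n)
      = - (\<Sum>i=0..n. coeff (F zs) i * (\<Sum>z\<leftarrow>zs. z ^ Suc (n - i)))" for zs n
    using arg_cong[OF newton[of zs], of "\<lambda>f. fps_nth f n"]
    by (simp add: fps_mult_nth P_def)
  have coeff_0: "coeff (F zs) 0 = 1" for zs
    by (induction zs) (simp_all add: F_def coeff_mult)
  have coeff_eq: "coeff (F xs) n = coeff (F ys) n" if "n \<le> length xs" for n
    using that
  proof (induction n rule: less_induct)
    case (less n)
    show ?case
    proof (cases n)
      case 0
      then show ?thesis by (simp add: coeff_0)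
    next
      case (Suc m)
      have "(\<Sum>i=0..m. coeff (F xs) i * (\<Sum>z\<leftarrow>xs. z ^ Suc (m - i)))
          = (\<Sum>i=0..m. coeff (F ys) i * (\<Sum>z\<leftarrow>ys. z ^ Suc (m - i)))"
        using less Suc by (intro sum.cong refl arg_cong2[where f = "(*)"] sums) auto
      then have "of_nat (Suc m) * coeff (F xs) n = of_nat (Suc m) * coeff (F ys) n"
        using rec[of m xs] rec[of m ys] Suc by simp
      then show ?thesis by (simp del: of_nat_Suc)
    qed
  qed
  have deg: "degree (F zs) \<le> length zs" for zs
  proof (induction zs)
    case (Cons z zs)
    have "degree (F (z # zs)) \<le> degree [:1, - z:] + degree (F zs)"
      unfolding F_def by (simp add: degree_mult_le del: mult_pCons_left degree_pCons_eq_if)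
    also have "\<dots> \<le> Suc (length zs)" using Cons by simp
    finally show ?case by simp
  qed (simp add: F_def)
  have F_eq: "F xs = F ys"
  proof (rule poly_eqI)
    fix n
    show "coeff (F xs) n = coeff (F ys) n"
      using coeff_eq[of n] deg[of xs] deg[of ys] len
      by (cases "n \<le> length xs") (simp_all add: coeff_eq_0)
  qed
  \<comment> \<open>\<open>F\<close> is the reversed polynomial, which loses the zero roots; \<open>length xs = length ys\<close> restores them.\<close>
  have reflect: "poly (\<Prod>z\<leftarrow>zs. [:- z, 1:]) t = t ^ length zs * poly (F zs) (inverse t)"
    if "t \<noteq> 0" for zs and t :: 'a
    using that by (induction zs) (simp_all add: F_def field_simps)
  \<comment> \<open>The reflection formula says nothing at \<open>t = 0\<close>. The extra factor
    \<open>[:0, 1:]\<close> makes both sides vanish there and is cancelled afterwards.\<close>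
  have "poly ([:0, 1:] * (\<Prod>x\<leftarrow>xs. [:- x, 1:])) t = poly ([:0, 1:] * (\<Prod>y\<leftarrow>ys. [:- y, 1:])) t" for t
    using reflect[of t xs] reflect[of t ys] F_eq len by (cases "t = 0") simp_all
  then have "[:0, 1:] * (\<Prod>x\<leftarrow>xs. [:- x, 1:]) = [:0, 1:] * (\<Prod>y\<leftarrow>ys. [:- y, 1:])"
    by (simp add: poly_eq_poly_eq_iff[symmetric] fun_eq_iff)
  then show ?thesis by simp
qed

section \<open>Traces of powers by triangularization\<close>

lemma mat_trace_mult_commute:
  fixes A B :: "'a::comm_semiring_0 Matrix.mat"
  assumes "A \<in> carrier_mat n m" "B \<in> carrier_mat m n"
  shows "mat_trace (A * B) = mat_trace (B * A)"
proof -
  have "mat_trace (A * B) = (\<Sum>i<n. \<Sum>j<m. A $$ (i, j) * B $$ (j, i))"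
    using assms by (simp add: mat_trace_def scalar_prod_def atLeast0LessThan)
  also have "\<dots> = (\<Sum>j<m. \<Sum>i<n. B $$ (j, i) * A $$ (i, j))"
    by (subst sum.swap) (simp add: mult.commute)
  also have "\<dots> = mat_trace (B * A)"
    using assms by (simp add: mat_trace_def scalar_prod_def atLeast0LessThan)
  finally show ?thesis .
qed

lemma mat_trace_similar:
  fixes A B :: "'a::comm_semiring_1 Matrix.mat"
  assumes "similar_mat_wit A B P Q"
  shows "mat_trace A = mat_trace B"
proof -
  note wit = similar_mat_witD[OF refl assms]
  have "mat_trace A = mat_trace (Q * (P * B))"
    by (subst wit(3), rule mat_trace_mult_commute) (use wit(5-7) in auto)
  also have "Q * (P * B) = B"
    using wit by (metis assoc_mult_mat left_mult_one_mat)
  finally show ?thesis .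
qed

text \<open>Both claims share one induction: triangularity of the power and of \<open>A\<close>
  kills every term of the diagonal entry of their product except the one with
  \<open>l = i\<close>.\<close>

lemma upper_triangular_pow:
  fixes A :: "'a::comm_semiring_1 Matrix.mat"
  assumes A: "A \<in> carrier_mat n n" and tri: "upper_triangular A"
  shows "upper_triangular (A ^\<^sub>m k) \<and> (\<forall>i<n. (A ^\<^sub>m k) $$ (i, i) = (A $$ (i, i)) ^ k)"
proof (induction k)
  case 0
  then show ?case using A by (auto simp: upper_triangular_def)
next
  case (Suc k)
  let ?B = "A ^\<^sub>m k"
  have B: "?B \<in> carrier_mat n n" using A by simp
  have prod: "(?B * A) $$ (i, j) = (\<Sum>l<n. ?B $$ (i, l) * A $$ (l, j))" if "i < n" "j < n" for i j
    using A B that by (simp add: scalar_prod_def atLeast0LessThan)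
  have zero: "?B $$ (i, l) * A $$ (l, j) = 0" if "i < n" "l < n" "j < l \<or> l < i" for i j l
    using Suc tri A B that by (auto simp: upper_triangular_def)
  have "(?B * A) $$ (i, j) = 0" if "i < n" "j < i" for i j
    using that by (subst prod) (auto intro!: sum.neutral zero)
  moreover have "(?B * A) $$ (i, i) = (A $$ (i, i)) ^ Suc k" if "i < n" for i
  proof -
    have "(?B * A) $$ (i, i) = (\<Sum>l\<in>{i}. ?B $$ (i, l) * A $$ (l, i))"
      unfolding prod[OF that that]
      by (rule sum.mono_neutral_right) (use that in \<open>auto intro!: zero\<close>)
    then show ?thesis using Suc that by (simp add: mult.commute)
  qed
  ultimately show ?case using A by (simp add: upper_triangular_def)
qed

text \<open>Schur decomposition gives a similar upper triangular matrix with diagonal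
  \<open>as\<close>; similarity preserves traces of powers, and powers of a triangular matrix act
  entrywise on the diagonal.\<close>

lemma mat_trace_pow_eq_power_sum:
  fixes A :: "'a::conjugatable_ordered_field Matrix.mat"
  assumes A: "A \<in> carrier_mat n n" and cp: "char_poly A = (\<Prod>a\<leftarrow>as. [:- a, 1:])"
  shows "mat_trace (A ^\<^sub>m k) = (\<Sum>a\<leftarrow>as. a ^ k)"
proof -
  obtain B P Q where schur: "schur_decomposition A as = (B, P, Q)"
    by (cases "schur_decomposition A as") auto
  have sim: "similar_mat_wit A B P Q" and tri: "upper_triangular B" and diag: "diag_mat B = as"
    using schur_decomposition[OF A cp schur] by auto
  have B: "B \<in> carrier_mat n n" using similar_mat_witD2[OF A sim] by auto
  have "mat_trace (A ^\<^sub>m k) = mat_trace (B ^\<^sub>m k)"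
    by (rule mat_trace_similar[OF similar_mat_wit_pow[OF sim]])
  also have "\<dots> = (\<Sum>i<n. (B $$ (i, i)) ^ k)"
    using B upper_triangular_pow[OF B tri] by (simp add: mat_trace_def)
  also have "\<dots> = (\<Sum>a\<leftarrow>as. a ^ k)"
    using B by (simp add: diag[symmetric] diag_mat_def sum_list_map_eq_sum_count o_def
        interv_sum_list_conv_sum_set_nat atLeast0LessThan)
  finally show ?thesis .
qed

text \<open>Over the complex numbers both characteristic polynomials split into \<open>n\<close>
  linear factors, and the traces are the power sums of their roots, so Newton's identities
  apply.\<close>

lemma char_poly_eq_of_trace_pow_eq:
  fixes A B :: "complex Matrix.mat"
  assumes A: "A \<in> carrier_mat n n" and B: "B \<in> carrier_mat n n"
    and tr: "\<And>k. k \<in> {1..n} \<Longrightarrow> mat_trace (A ^\<^sub>m k) = mat_trace (B ^\<^sub>m k)"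
  shows "char_poly A = char_poly B"
proof -
  obtain as where as: "char_poly A = (\<Prod>a\<leftarrow>as. [:- a, 1:])" "length as = n"
    using char_poly_factorized[OF A] by blast
  obtain bs where bs: "char_poly B = (\<Prod>b\<leftarrow>bs. [:- b, 1:])" "length bs = n"
    using char_poly_factorized[OF B] by blast
  show ?thesis
    unfolding as bs
    by (rule prod_linear_eq_of_power_sums_eq)
       (use as bs tr in \<open>auto simp: mat_trace_pow_eq_power_sum[OF A as(1), symmetric]
          mat_trace_pow_eq_power_sum[OF B bs(1), symmetric]\<close>)
qed

section \<open>Real spectrum of Hermitian matrices\<close>

lemma hermitian_eigenvalue_real:
  fixes A :: "complex Matrix.mat"
  assumes A: "A \<in> carrier_mat n n"
    and herm: "\<And>i j. i < n \<Longrightarrow> j < n \<Longrightarrow> A $$ (i, j) = cnj (A $$ (j, i))"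
    and ev: "eigenvalue A e"
  shows "e \<in> \<real>"
proof -
  obtain v where v: "v \<in> carrier_vec n" "v \<noteq> 0\<^sub>v n" "A *\<^sub>v v = e \<cdot>\<^sub>v v"
    using ev A by (auto simp: eigenvalue_def eigenvector_def)
  let ?v = "vec_index v"
  have row: "(\<Sum>j<n. A $$ (i, j) * ?v j) = e * ?v i" if "i < n" for i
    using arg_cong[OF v(3), of "\<lambda>w. vec_index w i"] A v(1) that
    by (simp add: scalar_prod_def atLeast0LessThan)
  \<comment> \<open>The quadratic form of \<open>A\<close> at the eigenvector \<open>v\<close>:
    Hermitian symmetry makes it real, while the eigenvalue equation makes it \<open>e\<close> times
    the positive squared norm of \<open>v\<close>.\<close>
  define S where "S = (\<Sum>i<n. \<Sum>j<n. cnj (?v i) * A $$ (i, j) * ?v j)"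
  have "cnj S = (\<Sum>j<n. \<Sum>i<n. cnj (?v j) * A $$ (j, i) * ?v i)"
    unfolding S_def by (subst sum.swap) (auto intro!: sum.cong simp: herm[symmetric])
  then have "cnj S = S" by (simp add: S_def)
  moreover have S: "S = e * complex_of_real (\<Sum>i<n. (cmod (?v i))\<^sup>2)"
  proof -
    have "S = (\<Sum>i<n. cnj (?v i) * (\<Sum>j<n. A $$ (i, j) * ?v j))"
      by (simp add: S_def sum_distrib_left mult.assoc)
    also have "\<dots> = (\<Sum>i<n. e * complex_of_real ((cmod (?v i))\<^sup>2))"
      by (intro sum.cong refl, subst row) (simp_all add: complex_norm_square mult_ac del: of_real_power)
    finally show ?thesis by (simp add: sum_distrib_left)
  qed
  moreover have "complex_of_real (\<Sum>i<n. (cmod (?v i))\<^sup>2) \<noteq> 0"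
  proof
    assume "complex_of_real (\<Sum>i<n. (cmod (?v i))\<^sup>2) = 0"
    then have "(\<Sum>i<n. (cmod (?v i))\<^sup>2) = 0"
      unfolding of_real_eq_0_iff .
    then have "\<forall>i<n. ?v i = 0" by (subst (asm) sum_nonneg_eq_0_iff) auto
    then have "v = 0\<^sub>v n" using v(1) by auto
    then show False using v(2) by simp
  qed
  ultimately have "cnj e = e"
    by (metis complex_cnj_complex_of_real complex_cnj_mult mult_right_cancel)
  then show ?thesis by (simp add: Reals_cnj_iff)
qed

text \<open>Justifies the definite description in \<open>sorted_eigenvalues\<close>: a sorted list
  exists because all roots are real, and it is unique because a polynomial determines the multiset
  of its roots.\<close>

lemma hermitian_sorted_eigenvalues:
  fixes A :: "complex Matrix.mat"
  assumes A: "A \<in> carrier_mat n n"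
    and herm: "\<And>i j. i < n \<Longrightarrow> j < n \<Longrightarrow> A $$ (i, j) = cnj (A $$ (j, i))"
  shows "char_poly A = (\<Prod>r\<leftarrow>sorted_eigenvalues A. [:- complex_of_real r, 1:])"
    and "length (sorted_eigenvalues A) = n"
proof -
  obtain as where as: "char_poly A = (\<Prod>a\<leftarrow>as. [:- a, 1:])" "length as = n"
    using char_poly_factorized[OF A] by blast
  have real: "a \<in> \<real>" if "a \<in> set as" for a
  proof (rule hermitian_eigenvalue_real[OF A herm])
    have "poly (char_poly A) a = (\<Prod>c\<leftarrow>as. a - c)"
      unfolding as by (simp add: poly_prod_list o_def)
    also have "\<dots> = 0" using that by (auto simp: prod_list_zero_iff)
    finally show "eigenvalue A a" by (simp add: eigenvalue_root_char_poly[OF A])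
  qed
  have mset_roots: "image_mset complex_of_real (mset ss) = proots (char_poly A)"
    if "char_poly A = (\<Prod>r\<leftarrow>ss. [:- complex_of_real r, 1:])" for ss
    unfolding that
  proof (induction ss)
    case (Cons r ss)
    have "(\<Prod>r\<leftarrow>ss. [:- complex_of_real r, 1:]) \<noteq> 0" by (auto simp: prod_list_zero_iff)
    then show ?case using Cons by (simp add: proots_mult del: mult_pCons_left)
  qed simp
  \<comment> \<open>Every root is real, so passing to real parts loses nothing.\<close>
  define rs where "rs = sort (map Re as)"
  have "sorted rs" by (simp add: rs_def)
  moreover have "char_poly A = (\<Prod>r\<leftarrow>rs. [:- complex_of_real r, 1:])"
  proof -
    have "mset (map (\<lambda>r. [:- complex_of_real r, 1:]) rs) = mset (map (\<lambda>a. [:- a, 1:]) as)"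
      using real by (auto simp: rs_def multiset.map_comp intro!: image_mset_cong)
    then show ?thesis unfolding as by (metis prod_mset_prod_list)
  qed
  moreover have "ss = rs" if "sorted ss" "char_poly A = (\<Prod>r\<leftarrow>ss. [:- complex_of_real r, 1:])" for ss
  proof -
    have "image_mset complex_of_real (mset ss) = image_mset complex_of_real (mset rs)"
      using mset_roots that(2) calculation(2) by metis
    then have "mset ss = mset rs"
      by (rule injD[OF multiset.inj_map[OF inj_of_real]])
    then show ?thesis using that(1) \<open>sorted rs\<close> by (metis properties_for_sort)
  qed
  ultimately have *: "sorted_eigenvalues A = rs"
    unfolding sorted_eigenvalues_def by (intro the_equality) blast+
  show "char_poly A = (\<Prod>r\<leftarrow>sorted_eigenvalues A. [:- complex_of_real r, 1:])"
    unfolding * by fact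
  show "length (sorted_eigenvalues A) = n" by (simp add: * rs_def as)
qed

section \<open>Powers of weighted adjacency matrices\<close>

definition walks :: "('a, 'e) pre_digraph \<Rightarrow> nat \<Rightarrow> 'a \<Rightarrow> 'a \<Rightarrow> 'e list set" where
  "walks H n u v = {p. pre_digraph.awalk H u p v \<and> length p = n}"

definition weighted_adj_mat ::
    "('a, 'e) pre_digraph \<Rightarrow> 'a list \<Rightarrow> ('e \<Rightarrow> 'c::comm_semiring_1) \<Rightarrow> 'c Matrix.mat" where
  "weighted_adj_mat H vs w = Matrix.mat (length vs) (length vs)
    (\<lambda>(i, j). \<Sum>e | e \<in> arcs H \<and> tail H e = vs ! i \<and> head H e = vs ! j. w e)"

context fin_digraph
begin

lemma finite_walks: "finite (walks G n u v)"
proof (rule finite_subset)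
  show "walks G n u v \<subseteq> {p. set p \<subseteq> arcs G \<and> length p = n}"
    by (auto simp: walks_def awalk_def)
qed (simp add: finite_lists_length_eq)

text \<open>The last arc is split off because \<open>Suc n\<close> unfolds a matrix power by
  multiplying on the right. The pairs determine the walk uniquely, so sums can be reindexed along
  this image.\<close>

lemma walks_Suc:
  "walks G (Suc n) u v =
    (\<lambda>(p, e). p @ [e]) ` (SIGMA p:(\<Union>x\<in>verts G. walks G n u x). {e \<in> arcs G. tail G e = awlast u p \<and> head G e = v})"
  (is "_ = ?R")
proof (intro equalityI subsetI)
  fix q assume q: "q \<in> walks G (Suc n) u v"
  then obtain p e where pe: "q = p @ [e]" "length p = n"
    by (auto simp: walks_def length_Suc_conv_rev)
  then have "awalk u p (awlast u p)" "awalk (awlast u p) [e] v"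
    using q by (auto simp: walks_def awalk_append_iff)
  then show "q \<in> ?R"
    using pe awalk_last_in_verts by (force simp: walks_def awalk_Cons_iff awalk_Nil_iff)
next
  fix q assume "q \<in> ?R"
  then obtain p e x where "q = p @ [e]" "awalk u p x" "length p = n"
      "e \<in> arcs G" "tail G e = awlast u p" "head G e = v"
    by (auto simp: walks_def)
  then show "q \<in> walks G (Suc n) u v"
    by (auto simp: walks_def awalk_append_iff awalk_Cons_iff awalk_Nil_iff)
qed

text \<open>In the product of the \<open>n\<close>-th power with the matrix, the summation index is
  the vertex at which the first \<open>n\<close> arcs end and the last arc starts.\<close>

lemma weighted_adj_mat_pow:
  assumes vs: "distinct vs" "set vs = verts G" and "i < length vs" "j < length vs"
  shows "(weighted_adj_mat G vs w ^\<^sub>m n) $$ (i, j) = (\<Sum>p\<in>walks G n (vs ! i) (vs ! j). \<Prod>e\<leftarrow>p. w e)"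
  using \<open>j < length vs\<close>
proof (induction n arbitrary: j)
  case 0
  have "walks G 0 (vs ! i) (vs ! j) = (if i = j then {[]} else {})"
    using vs \<open>i < length vs\<close> 0 by (auto simp: walks_def awalk_Nil_iff nth_eq_iff_index_eq)
  then show ?case
    using \<open>i < length vs\<close> 0 by (simp add: weighted_adj_mat_def)
next
  case (Suc n)
  let ?A = "weighted_adj_mat G vs w" and ?u = "vs ! i" and ?v = "vs ! j"
  let ?arcs = "\<lambda>x. {e \<in> arcs G. tail G e = x \<and> head G e = ?v}"
  have A: "?A \<in> carrier_mat (length vs) (length vs)"
    by (simp add: weighted_adj_mat_def)
  have bij: "bij_betw (\<lambda>l. vs ! l) {..<length vs} (verts G)"
    using bij_betw_nth[OF vs(1) refl vs(2)[symmetric]] .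
  have last: "awlast ?u p = x" if "p \<in> walks G n ?u x" for p x
    using that by (auto simp: walks_def)
  have "(?A ^\<^sub>m Suc n) $$ (i, j) = (\<Sum>l<length vs. (?A ^\<^sub>m n) $$ (i, l) * ?A $$ (l, j))"
    using \<open>i < length vs\<close> Suc.prems A by (simp add: scalar_prod_def atLeast0LessThan)
  also have "\<dots> = (\<Sum>l<length vs. \<Sum>p\<in>walks G n ?u (vs ! l). \<Sum>e\<in>?arcs (vs ! l). (\<Prod>e\<leftarrow>p. w e) * w e)"
    using Suc by (intro sum.cong refl) (simp add: weighted_adj_mat_def sum_product)
  also have "\<dots> = (\<Sum>x\<in>verts G. \<Sum>p\<in>walks G n ?u x. \<Sum>e\<in>?arcs x. (\<Prod>e\<leftarrow>p. w e) * w e)"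
    by (rule sum.reindex_bij_betw[OF bij])
  \<comment> \<open>Recovering the intermediate vertex from the walk itself removes \<open>x\<close>
    from the summand, so that the sums over \<open>x\<close> and \<open>p\<close> merge into one
    over a disjoint union.\<close>
  also have "\<dots> = (\<Sum>x\<in>verts G. \<Sum>p\<in>walks G n ?u x. \<Sum>e\<in>?arcs (awlast ?u p). (\<Prod>e\<leftarrow>p. w e) * w e)"
    by (intro sum.cong refl) (simp add: last)
  also have "\<dots> = (\<Sum>p\<in>(\<Union>x\<in>verts G. walks G n ?u x). \<Sum>e\<in>?arcs (awlast ?u p). (\<Prod>e\<leftarrow>p. w e) * w e)"
    by (rule sum.UNION_disjoint[symmetric]) (auto simp: finite_walks dest: last)
  also have "\<dots> = (\<Sum>(p, e)\<in>(SIGMA p:(\<Union>x\<in>verts G. walks G n ?u x). ?arcs (awlast ?u p)). (\<Prod>e\<leftarrow>p. w e) * w e)"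
    by (rule sum.Sigma) (auto simp: finite_walks)
  also have "\<dots> = (\<Sum>p\<in>walks G (Suc n) ?u ?v. \<Prod>e\<leftarrow>p. w e)"
    unfolding walks_Suc by (subst sum.reindex) (auto simp: inj_on_def case_prod_beta)
  finally show ?case .
qed

lemma mat_trace_weighted_adj_mat_pow:
  assumes vs: "distinct vs" "set vs = verts G"
  shows "mat_trace (weighted_adj_mat G vs w ^\<^sub>m n) = (\<Sum>u\<in>verts G. \<Sum>p\<in>walks G n u u. \<Prod>e\<leftarrow>p. w e)"
proof -
  have "mat_trace (weighted_adj_mat G vs w ^\<^sub>m n)
      = (\<Sum>i<length vs. \<Sum>p\<in>walks G n (vs ! i) (vs ! i). \<Prod>e\<leftarrow>p. w e)"
    unfolding mat_trace_def by (intro sum.cong)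
       (auto simp: weighted_adj_mat_def intro!: weighted_adj_mat_pow[OF vs, unfolded weighted_adj_mat_def])
  also have "\<dots> = (\<Sum>u\<in>verts G. \<Sum>p\<in>walks G n u u. \<Prod>e\<leftarrow>p. w e)"
    by (rule sum.reindex_bij_betw[OF bij_betw_nth[OF vs(1) refl vs(2)[symmetric]]])
  finally show ?thesis .
qed

end

section \<open>Trigonometric polynomials on the torus\<close>

abbreviation character :: "int ^ 'd::finite \<Rightarrow> real ^ 'd \<Rightarrow> complex" where
  "character m k \<equiv> exp (\<i> * inner (real_vec m) k)"

lemma real_vec_0 [simp]: "real_vec 0 = 0"
  and real_vec_add: "real_vec (m + m') = real_vec m + real_vec m'"
  and real_vec_uminus: "real_vec (- m) = - real_vec m"
  by (simp_all add: real_vec_def Finite_Cartesian_Product.vec_eq_iff)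

lemma character_add: "character (m + m') k = character m k * character m' k"
  by (simp add: real_vec_add inner_add_left distrib_left exp_add)

lemma cnj_character: "cnj (character m k) = character (- m) k"
  by (simp add: exp_cnj real_vec_uminus)

lemma character_interval_integral:
  "(LINT x|lborel. indicator {0..2 * pi} x *\<^sub>R exp (\<i> * (of_int n * complex_of_real x)))
    = (if n = 0 then 2 * pi else 0)"
proof (cases "n = 0")
  case True
  then show ?thesis by (simp add: measure_lborel_Icc scaleR_conv_of_real)
next
  case False
  define F where "F x = exp (\<i> * (of_int n * complex_of_real x)) / (\<i> * of_int n)" for x :: real
  have "(F has_vector_derivative exp (\<i> * (of_int n * complex_of_real x))) (at x within {0..2 * pi})" for x
    unfolding F_def
    by (rule has_vector_derivative_real_field) (use False in \<open>auto intro!: derivative_eq_intros simp: mult_ac\<close>)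
  moreover have "continuous_on {0..2 * pi} (\<lambda>x. exp (\<i> * (of_int n * complex_of_real x)))"
    by (intro continuous_intros)
  ultimately have "(LINT x|lborel. indicator {0..2 * pi} x *\<^sub>R exp (\<i> * (of_int n * complex_of_real x)))
      = F (2 * pi) - F 0"
    by (intro integral_FTC_Icc) auto
  also have "\<dots> = 0"
    using exp_integer_2pi[of "of_int n"] by (simp add: F_def mult_ac)
  finally show ?thesis using False by simp
qed

lemma character_integrable:
  "set_integrable lborel (cbox 0 (\<chi> s. 2 * pi)) (character m)"
  unfolding set_integrable_def by (rule borel_integrable_compact) (auto intro!: continuous_intros)

text \<open>Orthogonality of characters: the character on the cube factors over the coordinates, and
  a one-dimensional factor integrates to zero as soon as its integer frequency is nonzero.\<close>

lemma torus_mean_character: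
  fixes m :: "int ^ 'd::finite"
  shows "torus_mean (character m) = (if m = 0 then 1 else 0)"
proof -
  interpret product_sigma_finite "\<lambda>_ :: real ^ 'd. lborel :: real measure" ..
  let ?c = "(\<chi> s. 2 * pi) :: real ^ 'd"
  let ?g = "\<lambda>k. indicator (cbox 0 ?c) k *\<^sub>R character m k"
  let ?K = "\<lambda>x. \<Sum>u\<in>Basis. x u *\<^sub>R u :: real ^ 'd"
  \<comment> \<open>On a basis vector the inner product is a coordinate of \<open>m\<close>; the
    floor merely recovers it as an integer.\<close>
  define n where "n u = \<lfloor>inner (real_vec m) u\<rfloor>" for u
  have axis: "inner (real_vec m) (axis s 1) = of_int (vec_nth m s)" "inner ?c (axis s 1) = 2 * pi" for s
    by (simp_all add: inner_axis real_vec_def)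
  have n: "inner (real_vec m) u = of_int (n u)" "inner ?c u = 2 * pi" if "u \<in> Basis" for u
    using that by (auto simp: Basis_vec_def axis n_def)
  have n_eq_0: "(\<forall>u\<in>Basis. n u = 0) \<longleftrightarrow> m = 0"
    by (auto simp: Basis_vec_def n_def axis Finite_Cartesian_Product.vec_eq_iff)
  define f where
    "f u x = indicator {0..2 * pi} x *\<^sub>R exp (\<i> * (of_int (n u) * complex_of_real x))" for u x
  have f: "integral\<^sup>L lborel (f u) = (if n u = 0 then 2 * pi else 0)" for u
    unfolding f_def by (rule character_interval_integral)
  have f_integrable: "integrable lborel (f u)" for u
    unfolding f_def by (rule borel_integrable_compact) (auto intro!: continuous_intros)
  have g: "?g (?K x) = (\<Prod>u\<in>Basis. f u (x u))" for x
  proof -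
    have coord: "inner (?K x) u = x u" if "u \<in> Basis" for u
      using that by (rule inner_sum_left_Basis)
    have "indicator (cbox 0 ?c) (?K x) = (\<Prod>u\<in>Basis. indicator {0..2 * pi} (x u) :: real)"
    proof (cases "?K x \<in> cbox 0 ?c")
      case True
      then have "\<forall>u\<in>Basis. x u \<in> {0..2 * pi}"
        using coord n(2) by (auto simp: mem_box)
      then show ?thesis using True by simp
    next
      case False
      then obtain u where "u \<in> Basis" "x u \<notin> {0..2 * pi}"
        using coord n(2) by (auto simp: mem_box)
      then show ?thesis using False by (auto simp: indicator_def)
    qed
    moreover have "character m (?K x) = (\<Prod>u\<in>Basis. exp (\<i> * (of_int (n u) * complex_of_real (x u))))"
    proof -
      have "inner (real_vec m) (?K x) = (\<Sum>u\<in>Basis. of_int (n u) * x u)"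
        by (simp add: inner_sum_right n mult.commute)
      then show ?thesis by (simp add: sum_distrib_left exp_sum)
    qed
    ultimately show ?thesis by (simp add: f_def scaleR_conv_of_real prod.distrib)
  qed
  have "set_lebesgue_integral lborel (cbox 0 ?c) (character m) = integral\<^sup>L lborel ?g"
    by (simp add: set_lebesgue_integral_def)
  \<comment> \<open>Lebesgue measure is the image of the product measure under \<open>?K\<close>, so
    the integral of a product of one-variable functions splits.\<close>
  also have "\<dots> = (LINT x|Pi\<^sub>M Basis (\<lambda>_. lborel). ?g (?K x))"
    by (subst lborel_eq, rule integral_distr) measurable
  also have "\<dots> = (\<Prod>u\<in>(Basis :: (real ^ 'd) set). if n u = 0 then 2 * pi else 0)"
    unfolding g by (subst product_integral_prod) (simp_all add: f f_integrable)
  also have "\<dots> = (if m = 0 then (2 * pi) ^ CARD('d) else 0)"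
    using n_eq_0 by auto
  finally show ?thesis by (simp add: torus_mean_def)
qed

text \<open>An arbitrary index set allows several terms with the same frequency, which occur for the
  pairs of indices in the expansion of a square.\<close>

lemma torus_mean_sum:
  fixes t :: "'i \<Rightarrow> int ^ 'd::finite"
  assumes "finite I"
  shows "torus_mean (\<lambda>k. \<Sum>i\<in>I. a i * character (t i) k) = (\<Sum>i | i \<in> I \<and> t i = 0. a i)"
proof -
  let ?C = "cbox 0 (\<chi> s. 2 * pi) :: (real ^ 'd) set"
  have "set_lebesgue_integral lborel ?C (\<lambda>k. \<Sum>i\<in>I. a i * character (t i) k)
      = (LINT k|lborel. (\<Sum>i\<in>I. a i * (indicator ?C k *\<^sub>R character (t i) k)))"
    by (simp add: set_lebesgue_integral_def scaleR_sum_right)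
  also have "\<dots> = (\<Sum>i\<in>I. a i * set_lebesgue_integral lborel ?C (character (t i)))"
    using character_integrable unfolding set_integrable_def set_lebesgue_integral_def
    by (subst Bochner_Integration.integral_sum) (auto intro!: integrable_mult_right simp del: mult_scaleR_right)
  finally have "torus_mean (\<lambda>k. \<Sum>i\<in>I. a i * character (t i) k)
      = (\<Sum>i\<in>I. a i * torus_mean (character (t i)))"
    by (simp add: torus_mean_def sum_distrib_left mult_ac)
  then show ?thesis
    using assms by (simp add: torus_mean_character if_distrib sum.If_cases Int_def cong: if_cong)
qed

text \<open>The negated index matches the convention \<open>Tr = \<Sum> h\<^sub>m exp(-i\<langle>m, k\<rangle>)\<close>.\<close>

locale real_trig_poly =
  fixes f :: "real ^ 'd::finite \<Rightarrow> complex" and M :: "(int ^ 'd) set" and a :: "int ^ 'd \<Rightarrow> complex"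
  assumes finite_M: "finite M"
    and a_eq_0: "m \<notin> M \<Longrightarrow> a m = 0"
    and expansion: "f k = (\<Sum>m\<in>M. a m * character (- m) k)"
    and cnj_f: "cnj (f k) = f k"
begin

lemma fourier_coeff_eq: "fourier_coeff f m = a m"
proof -
  have "fourier_coeff f m = torus_mean (\<lambda>k. \<Sum>l\<in>M. a l * character (m - l) k)"
    by (simp add: fourier_coeff_def expansion sum_distrib_right mult.assoc
        flip: character_add)
  also have "\<dots> = (\<Sum>l | l \<in> M \<and> m - l = 0. a l)"
    using finite_M by (rule torus_mean_sum)
  also have "{l. l \<in> M \<and> m - l = 0} = (if m \<in> M then {m} else {})"
    by auto
  finally show ?thesis by (simp add: a_eq_0)
qed

lemma has_sum_fourier_coeff:
  "((\<lambda>m. fourier_coeff f m * character (- m) k) has_sum f k) UNIV"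
  unfolding fourier_coeff_eq expansion
  by (rule has_sum_finite_neutralI[OF finite_M]) (auto simp: a_eq_0)

lemma constant_iff: "(\<forall>k k'. f k = f k') \<longleftrightarrow> (\<forall>m. m \<noteq> 0 \<longrightarrow> a m = 0)"
proof
  assume const: "\<forall>k k'. f k = f k'"
  show "\<forall>m. m \<noteq> 0 \<longrightarrow> a m = 0"
  proof (intro allI impI)
    fix m :: "int ^ 'd" assume "m \<noteq> 0"
    obtain c where c: "\<And>k. f k = c" using const by metis
    \<comment> \<open>The constant times a character is written as a sum with a single term to match
      \<open>torus_mean_sum\<close>.\<close>
    have "fourier_coeff f m = torus_mean (\<lambda>k. \<Sum>i\<in>{()}. c * character m k)"
      by (simp add: fourier_coeff_def c)
    also have "\<dots> = 0" using \<open>m \<noteq> 0\<close> by (subst torus_mean_sum) auto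
    finally show "a m = 0" by (simp add: fourier_coeff_eq)
  qed
next
  assume *: "\<forall>m. m \<noteq> 0 \<longrightarrow> a m = 0"
  have "f k = (\<Sum>m\<in>M. a m)" for k
    unfolding expansion
  proof (rule sum.cong)
    fix m show "a m * character (- m) k = a m"
      using * by (cases "m = 0") auto
  qed simp
  then show "\<forall>k k'. f k = f k'" by simp
qed

text \<open>Since \<open>f\<close> is real, its square is \<open>f\<close> times its conjugate.
  Orthogonality then pairs each coefficient with its own conjugate, which gives Parseval's
  identity.\<close>

lemma torus_mean_square: "torus_mean (\<lambda>k. (f k)\<^sup>2) = (\<Sum>m\<in>M. (cmod (a m))\<^sup>2)"
proof -
  have "(f k)\<^sup>2 = (\<Sum>(m, l)\<in>M \<times> M. (a m * cnj (a l)) * character (l - m) k)" for k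
  proof -
    have "(f k)\<^sup>2 = f k * cnj (f k)" by (simp add: cnj_f power2_eq_square)
    also have "\<dots> = (\<Sum>m\<in>M. \<Sum>l\<in>M. (a m * character (- m) k) * (cnj (a l) * character l k))"
      unfolding expansion cnj_sum complex_cnj_mult cnj_character sum_product by simp
    also have "\<dots> = (\<Sum>m\<in>M. \<Sum>l\<in>M. (a m * cnj (a l)) * character (l - m) k)"
      by (intro sum.cong refl) (simp add: diff_conv_add_uminus character_add del: add_uminus_conv_diff)
    finally show ?thesis by (simp add: sum.cartesian_product)
  qed
  then have "torus_mean (\<lambda>k. (f k)\<^sup>2)
      = torus_mean (\<lambda>k. \<Sum>i\<in>M \<times> M. (a (fst i) * cnj (a (snd i))) * character (snd i - fst i) k)"
    by (simp add: case_prod_beta)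
  also have "\<dots> = (\<Sum>i | i \<in> M \<times> M \<and> snd i - fst i = 0. a (fst i) * cnj (a (snd i)))"
    using finite_M by (intro torus_mean_sum) simp
  also have "{i. i \<in> M \<times> M \<and> snd i - fst i = 0} = (\<lambda>m. (m, m)) ` M"
    by auto
  also have "(\<Sum>i\<in>(\<lambda>m. (m, m)) ` M. a (fst i) * cnj (a (snd i))) = (\<Sum>m\<in>M. a m * cnj (a m))"
    by (subst sum.reindex) (auto simp: inj_on_def)
  finally show ?thesis by (simp add: complex_norm_square flip: of_real_power)
qed

text \<open>After removal of the term at frequency zero, Parseval's identity leaves a sum of
  nonnegative reals, which vanishes only if each of them does.\<close>

lemma parseval_iff:
  "torus_mean (\<lambda>k. (f k)\<^sup>2) = (cmod (a 0))\<^sup>2 \<longleftrightarrow> (\<forall>m. m \<noteq> 0 \<longrightarrow> a m = 0)"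
proof -
  \<comment> \<open>If \<open>0\<close> lies outside \<open>M\<close>, then \<open>a 0 = 0\<close>,
    so inserting it does not change the sum.\<close>
  have "(\<Sum>m\<in>M. (cmod (a m))\<^sup>2) = (\<Sum>m\<in>insert 0 M. (cmod (a m))\<^sup>2)"
    using finite_M by (cases "0 \<in> M") (auto simp: insert_absorb a_eq_0)
  also have "\<dots> = (cmod (a 0))\<^sup>2 + (\<Sum>m\<in>M - {0}. (cmod (a m))\<^sup>2)"
    using finite_M by (simp add: sum.insert_remove)
  finally have eq: "torus_mean (\<lambda>k. (f k)\<^sup>2)
      = complex_of_real ((cmod (a 0))\<^sup>2 + (\<Sum>m\<in>M - {0}. (cmod (a m))\<^sup>2))"
    unfolding torus_mean_square by (metis of_real_power of_real_sum)
  have "torus_mean (\<lambda>k. (f k)\<^sup>2) = (cmod (a 0))\<^sup>2 \<longleftrightarrow> (\<Sum>m\<in>M - {0}. (cmod (a m))\<^sup>2) = 0"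
    unfolding eq of_real_power[symmetric] of_real_eq_iff by simp
  also have "\<dots> \<longleftrightarrow> (\<forall>m\<in>M - {0}. a m = 0)"
    using finite_M by (subst sum_nonneg_eq_0_iff) auto
  also have "\<dots> \<longleftrightarrow> (\<forall>m. m \<noteq> 0 \<longrightarrow> a m = 0)"
    using a_eq_0 by blast
  finally show ?thesis .
qed

end

section \<open>The fiber matrix as a weighted adjacency matrix\<close>

text \<open>The involution \<open>\<rho>\<close> matches the arcs in one direction with those in the
  other and conjugates their weights.\<close>

lemma weighted_adj_mat_hermitian:
  assumes rev: "\<And>e. e \<in> arcs H \<Longrightarrow> \<rho> e \<in> arcs H \<and> \<rho> (\<rho> e) = e \<and>
                  tail H (\<rho> e) = head H e \<and> head H (\<rho> e) = tail H e \<and> w (\<rho> e) = cnj (w e)"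
    and "i < length vs" "j < length vs"
  shows "weighted_adj_mat H vs w $$ (i, j) = cnj (weighted_adj_mat H vs w $$ (j, i))"
proof -
  have "(\<Sum>e | e \<in> arcs H \<and> tail H e = vs ! i \<and> head H e = vs ! j. w e)
      = (\<Sum>e | e \<in> arcs H \<and> tail H e = vs ! j \<and> head H e = vs ! i. cnj (w e))"
    by (rule sum.reindex_bij_witness[of _ \<rho> \<rho>]) (use rev in auto)
  then show ?thesis using assms(2,3) by (simp add: weighted_adj_mat_def)
qed

text \<open>On a quotient arc this is the weight -1 times the magnetic Bloch phase. The added loop
  carries the degree and the electric potential, which contribute only to the diagonal of the fiber
  operator.\<close>

definition arc_weight ::
    "(real ^ 'd::finite, 'e) pre_digraph \<Rightarrow> ('d \<Rightarrow> real ^ 'd) \<Rightarrow> ('e \<Rightarrow> real) \<Rightarrow>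
      (real ^ 'd \<Rightarrow> real) \<Rightarrow> real ^ 'd \<Rightarrow> 'e set + real ^ 'd \<Rightarrow> complex" where
  "arc_weight G b \<alpha> Q k = case_sum
    (\<lambda>E. - exp (\<i> * (on_orbit \<alpha> E + inner (real_vec (on_orbit (edge_index G b) E)) k)))
    (\<lambda>v. of_nat (out_degree G v) + complex_of_real (Q v))"

text \<open>The cycle weight is multiplicative and the flux and index are additive under prepending
  an arc, so the formula reduces to a single arc.\<close>

lemma prod_arc_weight:
  "(\<Prod>x\<leftarrow>c. arc_weight G b \<alpha> Q k x)
    = cycle_weight G Q c * exp (\<i> * cycle_flux \<alpha> c) * character (cycle_index G b c) k"
proof (induction c)
  case Nil
  then show ?case by (simp add: cycle_weight_def cycle_flux_def cycle_index_def)
next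
  case (Cons x c)
  have weight: "cycle_weight G Q (x # c) = cycle_weight G Q [x] * cycle_weight G Q c"
    and flux: "cycle_flux \<alpha> (x # c) = cycle_flux \<alpha> [x] + cycle_flux \<alpha> c"
    and index: "cycle_index G b (x # c) = cycle_index G b [x] + cycle_index G b c"
    by (simp_all add: cycle_weight_def cycle_flux_def cycle_index_def)
  have "arc_weight G b \<alpha> Q k x
      = cycle_weight G Q [x] * exp (\<i> * cycle_flux \<alpha> [x]) * character (cycle_index G b [x]) k"
    by (cases x)
       (simp_all add: arc_weight_def cycle_weight_def cycle_flux_def cycle_index_def distrib_left exp_add)
  then show ?case
    using Cons unfolding weight flux index
    by (simp add: character_add distrib_left exp_add mult_ac)
qed

context periodic_graph
begin

abbreviation Gq where "Gq \<equiv> quotient_graph G b act"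
abbreviation Gm where "Gm \<equiv> modified_graph G b act"

sublocale quotient: fin_digraph Gq by (rule finite_quotient)

lemma verts_Gq [simp]: "verts Gq = quotient_verts G b"
  by (simp add: quotient_graph_def)

sublocale modified: fin_digraph Gm
proof
  show "finite (verts Gm)" "finite (arcs Gm)"
    using quotient.finite_verts quotient.finite_arcs by (auto simp: modified_graph_def)
next
  fix e assume "e \<in> arcs Gm"
  then show "tail Gm e \<in> verts Gm" "head Gm e \<in> verts Gm"
    using quotient.tail_in_verts quotient.head_in_verts by (auto simp: modified_graph_def)
qed

lemma vert_list: "distinct (vert_list G b)" "set (vert_list G b) = quotient_verts G b"
proof -
  have "\<exists>vs. distinct vs \<and> set vs = quotient_verts G b"
    using finite_distinct_list quotient.finite_verts by auto
  from someI_ex[OF this]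
  show "distinct (vert_list G b)" "set (vert_list G b) = quotient_verts G b"
    unfolding vert_list_def by auto
qed

lemma length_vert_list [simp]: "length (vert_list G b) = num_verts G b"
  using vert_list distinct_card by (fastforce simp: num_verts_def)

lemma arcs_Gq_cases:
  assumes "E \<in> arcs Gq"
  obtains e where "e \<in> arcs G" "E = edge_orbit b act e"
  using assms by (auto simp: quotient_graph_def)

text \<open>Links the loop weight, defined by the degree in \<open>G\<close>, to the number of terms
  in the fiber operator, which sums over quotient arcs.\<close>

lemma out_degree_Gq: "v \<in> quotient_verts G b \<Longrightarrow> card (out_arcs Gq v) = out_degree G v"
  using bij_betw_same_card[OF bij_betw_out_arcs] by (simp add: out_degree_def)

text \<open>Applied to the indicator of \<open>v\<close>, each arc out of \<open>u\<close> yields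
  its weight if it ends at \<open>v\<close>, and a further 1 if \<open>u = v\<close>; these ones add
  up to the degree and join the potential in the weight of the added loop.\<close>

lemma fiber_mat_eq: "fiber_mat G b act \<alpha> Q k = weighted_adj_mat Gm (vert_list G b) (arc_weight G b \<alpha> Q k)"
proof (rule eq_matI)
  let ?vs = "vert_list G b" and ?w = "arc_weight G b \<alpha> Q k"
  fix i j
  assume "i < dim_row (weighted_adj_mat Gm ?vs ?w)" "j < dim_col (weighted_adj_mat Gm ?vs ?w)"
  then have ij: "i < num_verts G b" "j < num_verts G b" by (simp_all add: weighted_adj_mat_def)
  define u v where "u = ?vs ! i" and "v = ?vs ! j"
  have uv: "u \<in> quotient_verts G b" "v \<in> quotient_verts G b"
    using ij vert_list(2) nth_mem[of _ ?vs] by (auto simp: u_def v_def)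
  have fin: "finite (out_arcs Gq u)" by (rule finite_subset[OF _ quotient.finite_arcs]) auto
  have arcs: "{e \<in> arcs Gm. tail Gm e = u \<and> head Gm e = v}
      = Inl ` {E \<in> out_arcs Gq u. head Gq E = v} \<union> Inr ` (if u = v then {u} else {})"
    using uv by (auto simp: modified_graph_def)
  have "fiber_mat G b act \<alpha> Q k $$ (i, j)
      = fiber_op G b act \<alpha> Q k (\<lambda>x. if x = v then 1 else 0) u"
    using ij by (simp add: fiber_mat_def u_def v_def)
  also have "\<dots> = (\<Sum>E\<in>out_arcs Gq u. (if u = v then 1 else 0) + (if head Gq E = v then ?w (Inl E) else 0))
      + complex_of_real (Q u) * (if u = v then 1 else 0)"
    unfolding fiber_op_def by (intro arg_cong2[where f = "(+)"] sum.cong refl) (simp add: arc_weight_def)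
  also have "\<dots> = (\<Sum>E | E \<in> out_arcs Gq u \<and> head Gq E = v. ?w (Inl E)) + (if u = v then ?w (Inr u) else 0)"
    unfolding sum.distrib sum.inter_filter[OF fin] sum_constant out_degree_Gq[OF uv(1)]
    by (simp add: arc_weight_def)
  also have "\<dots> = (\<Sum>e | e \<in> arcs Gm \<and> tail Gm e = u \<and> head Gm e = v. ?w e)"
    unfolding arcs using fin
    by (subst sum.union_disjoint) (auto simp: sum.reindex)
  finally show "fiber_mat G b act \<alpha> Q k $$ (i, j) = weighted_adj_mat Gm ?vs ?w $$ (i, j)"
    using ij by (simp add: weighted_adj_mat_def u_def v_def)
qed (simp_all add: fiber_mat_def weighted_adj_mat_def)

lemma fiber_mat_carrier: "fiber_mat G b act \<alpha> Q k \<in> carrier_mat (num_verts G b) (num_verts G b)"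
  by (simp add: fiber_mat_def)

section \<open>Hermitian symmetry, band functions and cycle expansion of the traces\<close>

context
  fixes \<alpha> :: "'e \<Rightarrow> real"
  assumes \<alpha>: "periodic_magnetic_potential G arev b act \<alpha>"
begin

lemma orbit_\<alpha>: "e \<in> arcs G \<Longrightarrow> on_orbit \<alpha> (edge_orbit b act e) = \<alpha> e"
  using \<alpha> by (intro on_orbit_eq) (auto simp: periodic_magnetic_potential_def)

text \<open>Reversal of quotient arcs negates both magnetic potential and index, hence conjugates
  the phase; the added loops are fixed and have real weight.\<close>

lemma fiber_mat_hermitian:
  assumes "i < num_verts G b" "j < num_verts G b"
  shows "fiber_mat G b act \<alpha> Q k $$ (i, j) = cnj (fiber_mat G b act \<alpha> Q k $$ (j, i))"
  unfolding fiber_mat_eq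
proof (rule weighted_adj_mat_hermitian[where \<rho> = "map_sum ((`) arev) id"])
  let ?rev = "map_sum ((`) arev) id" and ?w = "arc_weight G b \<alpha> Q k"
  fix x assume x: "x \<in> arcs Gm"
  show "?rev x \<in> arcs Gm \<and> ?rev (?rev x) = x \<and> tail Gm (?rev x) = head Gm x \<and>
      head Gm (?rev x) = tail Gm x \<and> ?w (?rev x) = cnj (?w x)"
  proof (cases x)
    case (Inl E)
    then obtain e where e: "e \<in> arcs G" "E = edge_orbit b act e"
      using x by (auto simp: modified_graph_def elim: arcs_Gq_cases)
    have arev_e: "arev e \<in> arcs G" using e(1) by simp
    \<comment> \<open>Reversal commutes with the lattice action, so it maps orbits onto
      orbits.\<close>
    have rev: "arev ` E = edge_orbit b act (arev e)"
      using e by (auto simp: edge_orbit_def image_image arev_act intro!: image_cong)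
    have "\<alpha> (arev e) = - \<alpha> e" "edge_index G b (arev e) = - edge_index G b e"
      using \<alpha> e by (auto simp: periodic_magnetic_potential_def edge_index_def)
    then have "?w (Inl (arev ` E)) = cnj (?w (Inl E))"
      using e arev_e unfolding rev
      by (simp add: arc_weight_def orbit_\<alpha> orbit_edge_index exp_cnj real_vec_uminus algebra_simps)
    moreover have "edge_orbit b act (arev e) \<in> arcs Gq"
      using arev_e by (simp add: quotient_graph_def)
    moreover have "arev ` arev ` E = E" by (simp add: image_image)
    ultimately show ?thesis
      using e arev_e rev Inl by (simp add: modified_graph_def quotient_tail quotient_head InlI)
  next
    case (Inr v)
    then show ?thesis using x by (simp add: modified_graph_def arc_weight_def)
  qed
qed (use assms in simp_all)

text \<open>The trace is a power sum of the real eigenvalues of a Hermitian matrix.\<close>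

lemma cnj_fiber_trace: "cnj (fiber_trace G b act \<alpha> Q n k) = fiber_trace G b act \<alpha> Q n k"
proof -
  let ?A = "fiber_mat G b act \<alpha> Q k"
  have "char_poly ?A = (\<Prod>a\<leftarrow>map complex_of_real (sorted_eigenvalues ?A). [:- a, 1:])"
    using hermitian_sorted_eigenvalues(1)[OF fiber_mat_carrier fiber_mat_hermitian] by (simp add: o_def)
  from mat_trace_pow_eq_power_sum[OF fiber_mat_carrier this]
  have trace: "fiber_trace G b act \<alpha> Q n k = (\<Sum>r\<leftarrow>sorted_eigenvalues ?A. complex_of_real r ^ n)"
    by (simp add: fiber_trace_def o_def)
  have "cnj (\<Sum>r\<leftarrow>rs. complex_of_real r ^ n) = (\<Sum>r\<leftarrow>rs. complex_of_real r ^ n)" for rs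
    by (induction rs) simp_all
  then show ?thesis unfolding trace .
qed

text \<open>Both sides are equivalent to a characteristic polynomial independent of
  \<open>k\<close>: it encodes the sorted eigenvalues, and it determines and is determined by the
  first \<open>?\<nu>\<close> traces.\<close>

lemma flat_spectrum_iff_traces_constant:
  "flat_spectrum G b act \<alpha> Q \<longleftrightarrow>
    (\<forall>n\<in>{1..num_verts G b}. \<forall>k k'. fiber_trace G b act \<alpha> Q n k = fiber_trace G b act \<alpha> Q n k')"
proof -
  let ?A = "fiber_mat G b act \<alpha> Q" and ?\<nu> = "num_verts G b"
  note eigenvalues = hermitian_sorted_eigenvalues[OF fiber_mat_carrier fiber_mat_hermitian]
  have flat: "flat_spectrum G b act \<alpha> Q \<longleftrightarrow> (\<forall>k k'. char_poly (?A k) = char_poly (?A k'))"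
  proof
    assume *: "flat_spectrum G b act \<alpha> Q"
    have "sorted_eigenvalues (?A k) = sorted_eigenvalues (?A k')" for k k'
    proof (rule nth_equalityI)
      fix i assume "i < length (sorted_eigenvalues (?A k))"
      \<comment> \<open>Band functions are numbered from 1, list positions from 0.\<close>
      then have "Suc i \<in> {1..?\<nu>}" by (simp add: eigenvalues(2))
      then have "band_function G b act \<alpha> Q (Suc i) k = band_function G b act \<alpha> Q (Suc i) k'"
        using * unfolding flat_spectrum_def by blast
      then show "sorted_eigenvalues (?A k) ! i = sorted_eigenvalues (?A k') ! i"
        by (simp add: band_function_def)
    qed (simp add: eigenvalues(2))
    then show "\<forall>k k'. char_poly (?A k) = char_poly (?A k')"
      using eigenvalues(1) by metis
  next
    assume *: "\<forall>k k'. char_poly (?A k) = char_poly (?A k')"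
    \<comment> \<open>The matrix enters the definition of \<open>sorted_eigenvalues\<close> only
      through its characteristic polynomial.\<close>
    have "sorted_eigenvalues (?A k) = sorted_eigenvalues (?A k')" for k k'
      unfolding sorted_eigenvalues_def by (subst *[rule_format, of k k']) (rule refl)
    then show "flat_spectrum G b act \<alpha> Q"
      unfolding flat_spectrum_def band_function_def
      by (intro ballI allI arg_cong2[where f = "(!)"] refl)
  qed
  show ?thesis
    unfolding flat
  proof
    assume *: "\<forall>k k'. char_poly (?A k) = char_poly (?A k')"
    show "\<forall>n\<in>{1..?\<nu>}. \<forall>k k'. fiber_trace G b act \<alpha> Q n k = fiber_trace G b act \<alpha> Q n k'"
    proof (intro ballI allI)
      fix n k k'
      obtain as where "char_poly (?A k) = (\<Prod>a\<leftarrow>as. [:- a, 1:])"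
        using char_poly_factorized[OF fiber_mat_carrier] by blast
      moreover from this have "char_poly (?A k') = (\<Prod>a\<leftarrow>as. [:- a, 1:])"
        unfolding *[rule_format, of k' k] .
      ultimately show "fiber_trace G b act \<alpha> Q n k = fiber_trace G b act \<alpha> Q n k'"
        unfolding fiber_trace_def by (simp add: mat_trace_pow_eq_power_sum[OF fiber_mat_carrier])
    qed
  next
    assume "\<forall>n\<in>{1..?\<nu>}. \<forall>k k'. fiber_trace G b act \<alpha> Q n k = fiber_trace G b act \<alpha> Q n k'"
    then show "\<forall>k k'. char_poly (?A k) = char_poly (?A k')"
      unfolding fiber_trace_def
      by (intro allI char_poly_eq_of_trace_pow_eq[OF fiber_mat_carrier fiber_mat_carrier]) blast
  qed
qed

text \<open>Grouping the finitely many closed walks of length \<open>n\<close> by their index turns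
  the walk expansion of the trace into its Fourier series.\<close>

lemma real_trig_poly_fiber_trace:
  assumes "n \<ge> 1"
  shows "real_trig_poly (fiber_trace G b act \<alpha> Q n)
    (cycle_index G b ` (\<Union>u\<in>verts Gm. walks Gm n u u)) (cycle_sum G b act \<alpha> Q n)"
proof
  let ?C = "\<Union>u\<in>verts Gm. walks Gm n u u"
  have fin: "finite ?C" by (simp add: modified.finite_walks)
  then show "finite (cycle_index G b ` ?C)" by simp
  have cycles: "cycles G b act n m = {c \<in> ?C. cycle_index G b c = m}" for m
    using assms modified.awalk_hd_in_verts by (auto simp: cycles_def walks_def)
  show "cycle_sum G b act \<alpha> Q n m = 0" if "m \<notin> cycle_index G b ` ?C" for m
  proof -
    have "cycles G b act n m = {}" using that by (auto simp: cycles)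
    then show ?thesis by (simp add: cycle_sum_def)
  qed
  show "cnj (fiber_trace G b act \<alpha> Q n k) = fiber_trace G b act \<alpha> Q n k" for k
    by (rule cnj_fiber_trace)
  show "fiber_trace G b act \<alpha> Q n k
      = (\<Sum>m\<in>cycle_index G b ` ?C. cycle_sum G b act \<alpha> Q n m * character (- m) k)" for k
  proof -
    let ?W = "\<lambda>c. cycle_weight G Q c * exp (- \<i> * cycle_flux \<alpha> c)"
    \<comment> \<open>For \<open>n \<ge> 1\<close> the first arc determines the base vertex; the
      empty walk would instead be counted once at every vertex.\<close>
    have disj: "walks Gm n u u \<inter> walks Gm n v v = {}" if "u \<noteq> v" for u v
    proof -
      have "u = v" if "p \<in> walks Gm n u u" "p \<in> walks Gm n v v" for p
        using that assms by (cases p) (auto simp: walks_def modified.awalk_Cons_iff)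
      then show ?thesis using that by blast
    qed
    have "fiber_trace G b act \<alpha> Q n k = (\<Sum>u\<in>verts Gm. \<Sum>c\<in>walks Gm n u u. \<Prod>x\<leftarrow>c. arc_weight G b \<alpha> Q k x)"
      unfolding fiber_trace_def fiber_mat_eq
      by (rule modified.mat_trace_weighted_adj_mat_pow) (simp_all add: vert_list modified_graph_def)
    also have "\<dots> = (\<Sum>c\<in>?C. \<Prod>x\<leftarrow>c. arc_weight G b \<alpha> Q k x)"
      by (rule sum.UNION_disjoint[symmetric]) (use disj in \<open>auto simp: modified.finite_walks\<close>)
    \<comment> \<open>The walk expansion carries positive flux and index. Conjugation reverses both
      signs, as the Fourier convention requires, and leaves the real trace unchanged.\<close>
    finally have "cnj (fiber_trace G b act \<alpha> Q n k)
        = (\<Sum>c\<in>?C. ?W c * character (- cycle_index G b c) k)"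
      by (simp add: prod_arc_weight exp_cnj real_vec_uminus)
    also have "\<dots> = (\<Sum>m\<in>cycle_index G b ` ?C. \<Sum>c | c \<in> ?C \<and> cycle_index G b c = m.
        ?W c * character (- cycle_index G b c) k)"
      by (rule sum.image_gen[OF fin])
    also have "\<dots> = (\<Sum>m\<in>cycle_index G b ` ?C. cycle_sum G b act \<alpha> Q n m * character (- m) k)"
      unfolding cycle_sum_def cycles sum_distrib_right by (intro sum.cong refl) auto
    finally show ?thesis by (simp add: cnj_fiber_trace)
  qed
qed

end

end

section \<open>The equivalences\<close>

theorem theorem2p5:
  fixes G :: "(real ^ 'd::finite, 'e) pre_digraph" and arev :: "'e \<Rightarrow> 'e"
    and b :: "'d \<Rightarrow> real ^ 'd" and act :: "real ^ 'd \<Rightarrow> 'e \<Rightarrow> 'e"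
    and \<alpha> :: "'e \<Rightarrow> real" and Q :: "real ^ 'd \<Rightarrow> real"
  assumes "periodic_graph G arev b act"
    and "periodic_magnetic_potential G arev b act \<alpha>"
    and "periodic_electric_potential G b Q"
  shows
    "let \<nu> = num_verts G b;
         Tr = fiber_trace G b act \<alpha> Q;
         h = (\<lambda>n. fourier_coeff (Tr n));
         S = cycle_sum G b act \<alpha> Q
     in
       (\<forall>n\<ge>1. \<forall>k. ((\<lambda>m. h n m * exp (- \<i> * inner (real_vec m) k)) has_sum Tr n k) UNIV) \<and>
       (\<forall>n\<ge>1. \<forall>m. h n m = S n m) \<and>
       (flat_spectrum G b act \<alpha> Q \<longleftrightarrow>
          (\<forall>n\<in>{1..\<nu>}. \<forall>k k'. Tr n k = Tr n k')) \<and>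
       (flat_spectrum G b act \<alpha> Q \<longleftrightarrow>
          (\<forall>n\<in>{1..\<nu>}. \<forall>m. m \<noteq> 0 \<longrightarrow> h n m = S n m \<and> S n m = 0)) \<and>
       (flat_spectrum G b act \<alpha> Q \<longleftrightarrow>
          (\<forall>n\<in>{1..\<nu>}. torus_mean (\<lambda>k. (Tr n k)\<^sup>2) = (cmod (h n 0))\<^sup>2 \<and> h n 0 = S n 0))"
proof -
  interpret periodic_graph G arev b act by fact
  let ?Tr = "fiber_trace G b act \<alpha> Q" and ?S = "cycle_sum G b act \<alpha> Q"
  note trig = real_trig_poly_fiber_trace[OF assms(2)]
  have h: "fourier_coeff (?Tr n) m = ?S n m" if "n \<ge> 1" for n m
    using real_trig_poly.fourier_coeff_eq[OF trig[OF that]] .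
  have series: "((\<lambda>m. fourier_coeff (?Tr n) m * exp (- \<i> * inner (real_vec m) k)) has_sum ?Tr n k) UNIV"
    if "n \<ge> 1" for n k
    using real_trig_poly.has_sum_fourier_coeff[OF trig[OF that], of Q k] by (simp add: real_vec_uminus)
  have const: "(\<forall>k k'. ?Tr n k = ?Tr n k') \<longleftrightarrow> (\<forall>m. m \<noteq> 0 \<longrightarrow> ?S n m = 0)" if "n \<ge> 1" for n
    by (rule real_trig_poly.constant_iff[OF trig[OF that]])
  have parseval: "torus_mean (\<lambda>k. (?Tr n k)\<^sup>2) = (cmod (?S n 0))\<^sup>2 \<longleftrightarrow> (\<forall>m. m \<noteq> 0 \<longrightarrow> ?S n m = 0)"
    if "n \<ge> 1" for n
    by (rule real_trig_poly.parseval_iff[OF trig[OF that]])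
  note flat = flat_spectrum_iff_traces_constant[OF assms(2), of Q]
  \<comment> \<open>The vanishing of the cycle sums of nonzero index serves as the common form to
    which the other conditions are compared.\<close>
  also have "(\<forall>n\<in>{1..num_verts G b}. \<forall>k k'. ?Tr n k = ?Tr n k') \<longleftrightarrow>
      (\<forall>n\<in>{1..num_verts G b}. \<forall>m. m \<noteq> 0 \<longrightarrow> ?S n m = 0)"
    by (intro ball_cong refl const) simp
  finally have flat_S: "flat_spectrum G b act \<alpha> Q \<longleftrightarrow>
      (\<forall>n\<in>{1..num_verts G b}. \<forall>m. m \<noteq> 0 \<longrightarrow> ?S n m = 0)" .
  also have "\<dots> \<longleftrightarrow> (\<forall>n\<in>{1..num_verts G b}.
      torus_mean (\<lambda>k. (?Tr n k)\<^sup>2) = (cmod (fourier_coeff (?Tr n) 0))\<^sup>2 \<and>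
      fourier_coeff (?Tr n) 0 = ?S n 0)"
  proof (intro ball_cong refl)
    fix n assume "n \<in> {1..num_verts G b}"
    then have n: "n \<ge> 1" by simp
    show "(\<forall>m. m \<noteq> 0 \<longrightarrow> ?S n m = 0) \<longleftrightarrow>
        torus_mean (\<lambda>k. (?Tr n k)\<^sup>2) = (cmod (fourier_coeff (?Tr n) 0))\<^sup>2 \<and>
        fourier_coeff (?Tr n) 0 = ?S n 0"
      unfolding h[OF n] parseval[OF n] by simp
  qed
  finally have flat_parseval: "flat_spectrum G b act \<alpha> Q \<longleftrightarrow> (\<forall>n\<in>{1..num_verts G b}.
      torus_mean (\<lambda>k. (?Tr n k)\<^sup>2) = (cmod (fourier_coeff (?Tr n) 0))\<^sup>2 \<and>
      fourier_coeff (?Tr n) 0 = ?S n 0)" .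
  \<comment> \<open>The identity \<open>h\<close> supplies the equality of Fourier coefficient and
    cycle sum, and \<open>flat_S\<close> the vanishing.\<close>
  have flat_h: "flat_spectrum G b act \<alpha> Q \<longleftrightarrow> (\<forall>n\<in>{1..num_verts G b}. \<forall>m. m \<noteq> 0 \<longrightarrow>
      fourier_coeff (?Tr n) m = ?S n m \<and> ?S n m = 0)"
    unfolding flat_S using h by auto
  show ?thesis
    unfolding Let_def by (intro conjI flat flat_h flat_parseval allI impI series h)
qed

end
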